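(* In the setting described in the context, assume that each minimization problem defining the iterates has a solution, that the tangential cone condition of type A or of type B holds with constants $\eta\ge0$, $C_{\rm tc}\ge1$, that the additive variational source condition holds with $u^*$, $\beta_1\in[0,1/2)$, $\beta_2>0$ and index function $\varphi$, and that there is a uniform upper bound $\mathbf{err}_n\le\mathbf{err}$ for all $n$. Suppose that $\eta$, $\beta_2$, $\mathcal D_{\mathcal R}^{u^*}(u_0,u^\dagger)$ and $\mathcal T(g^\dagger;F(u_0))$ are sufficiently small. (1) Exact data: the iterates $(u_n)$ with exact data $g^{\rm obs}=g^\dagger$ satisfy $$\mathcal D_{\mathcal R}^{u^*}(u_n,u^\dagger)=\mathcal O(\Lambda(\alpha_n)),\qquad n\to\infty.$$ (2) A priori stopping rule: for noisy data and $n_*:=\min\{n\in\mathbb N:\varPsi(\alpha_n)\le\mathbf{err}\}$, $$\mathcal D_{\mathcal R}^{u^*}(u_{n_*},u^\dagger)=\mathcal O\big(\Lambda(\varPsi^{-1}(\mathbf{err}))\big),\qquad\mathbf{err}\to0.$$ (3) Lepskiĭ-type stopping rule: assume in addition that there are $q>1$ and $C_{\rm bd}>0$ with $\|u-u^\dagger\|^q\le C_{\rm bd}\mathcal D_{\mathcal R}^{u^*}(u,u^\dagger)$ for all $u\in\mathcal X$. Let $$N_{\max}:=\min\{n\in\mathbb N: C_{\rm bd}^{1/q}\Phi_{\rm noi}(n)^{1/q}\ge1\},$$ $$n_{\rm bal}:=\min\{n\in\{1,\dots,N_{\max}\}:\ \forall m\ge n\ \ \|u_n-u_m\|\le c\,\Phi_{\rm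 noi}(m)^{1/q}\}$$ with $c=4C_{\rm bd}^{1/q}(1+\gamma_{\rm nl})$. Then $$\|u_{n_{\rm bal}}-u^\dagger\|^q=\mathcal O\big(\Lambda(\varPsi^{-1}(\mathbf{err}))\big),\qquad\mathbf{err}\to0.$$
   Context: Here $\mathbb N$ includes $0$. An index function is a continuous, monotonically increasing function $\varphi:[0,\infty)\to[0,\infty)$ with $\varphi(0)=0$. Operator and penalty. $\mathcal X,\mathcal Y$ are Banach spaces, $\mathfrak B\subset\mathcal X$ is convex. $F:\mathfrak B\to\mathcal Y$ is injective and continuous; the first variations $F'(u;v-u):=\lim_{t\searrow0}\frac1t(F(u+t(v-u))-F(u))$ exist for all $u,v\in\mathfrak B$, and $h\mapsto F'(u;h)$ extends to a bounded linear operator $F'[u]\in L(\mathcal X,\mathcal Y)$ for all $u\in\mathfrak B$. $\mathcal R:\mathcal X\to(-\infty,\infty]$ is proper and convex. Data. $u^\dagger\in\mathfrak B$ is the exact solution, $g^\dagger:=F(u^\dagger)$. $\mathcal Y^{\rm obs}$ is a set containing all possible observations and $g^{\rm obs}\in\mathcal Y^{\rm obs}$ is the observed data. $\mathcal T:F(\mathfrak B)\times\mathcal Y\to[0,\infty]$ satisfies $\mathcal T(g^\dagger;g^\dagger)=0$. $\mathcal S:\mathcal Y^{\rm obs}\times\mathcal Y\to(-\infty,\infty]$ (normalized by subtracting an additive constant $\mathfrak s(g^\dagger)$, so that $\mathfrak s\equiv0$) is such that there are $C_{\rm err}\ge1$ and $\mathbf{err}(\cdot):\mathcal Y\to[0,\infty]$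 with $$\mathcal S(g^{\rm obs};g)\le C_{\rm err}\mathcal T(g^\dagger;g)+C_{\rm err}\mathbf{err}(g),\qquad \mathcal T(g^\dagger;g)\le C_{\rm err}\mathcal S(g^{\rm obs};g)+C_{\rm err}\mathbf{err}(g)\qquad\forall g\in\mathcal Y.$$ "Exact data" means $g^{\rm obs}=g^\dagger$, with $\mathbf{err}(\cdot)\equiv0$ and $\mathbf{err}=0$. Iteration. For an initial guess $u_0\in\mathfrak B$, for $n\in\mathbb N$ let $u_{n+1}$ be a minimizer over $u\in\mathfrak B$ of $$\mathcal S(g^{\rm obs};F(u_n)+F'(u_n;u-u_n))+\alpha_n\mathcal R(u);$$ a minimizer is assumed to exist. The parameters satisfy $\alpha_0\le1$, $\alpha_n\searrow0$, $1\le\alpha_n/\alpha_{n+1}\le C_{\rm dec}$ for all $n$. Tangential cone condition of type A (constants $\eta$, $C_{\rm tc}\ge1$): for all $g^{\rm obs}\in\mathcal Y^{\rm obs}$ and all $u,v\in\mathfrak B$, $$\tfrac1{C_{\rm tc}}\mathcal S(g^{\rm obs};F(v))-\eta\,\mathcal S(g^{\rm obs};F(u))\le\mathcal S(g^{\rm obs};F(u)+F'(u;v-u))\le C_{\rm tc}\mathcal S(g^{\rm obs};F(v))+\eta\,\mathcal S(g^{\rm obs};F(u)).$$ Type B: for all $u,v\in\mathfrak B$, $$\tfrac1{C_{\rm tc}}\mathcal T(g^\dagger;F(v))-\eta\,\mathcal T(g^\dagger;F(u))\le\mathcal T(g^\dagger;F(u)+F'(u;v-u))\le C_{\rm tc}\mathcal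 T(g^\dagger;F(v))+\eta\,\mathcal T(g^\dagger;F(u)).$$ Error terms. In case of type A, $\mathbf{err}_n:=\frac1{C_{\rm tc}}\mathbf{err}(F(u_{n+1}))+2\eta C_{\rm err}\mathbf{err}(F(u_n))+C_{\rm tc}C_{\rm err}\mathbf{err}(g^\dagger)$; in case of type B, $\mathbf{err}_n:=\mathbf{err}(F(u_n)+F'(u_n;u_{n+1}-u_n))+C_{\rm err}\mathbf{err}(F(u_n)+F'(u_n;u^\dagger-u_n))$. The number $\mathbf{err}\ge0$ is a uniform upper bound: $\mathbf{err}_n\le\mathbf{err}$ for all $n$. Bregman distance: for $u^*\in\partial\mathcal R(u^\dagger)$, $\mathcal D_{\mathcal R}^{u^*}(u,u^\dagger):=\mathcal R(u)-\mathcal R(u^\dagger)-\langle u^*,u-u^\dagger\rangle$. Additive variational source condition: there are $u^*\in\partial\mathcal R(u^\dagger)\subset\mathcal X'$, $\beta_1\in[0,1/2)$, $\beta_2>0$ and a strictly concave, differentiable index function $\varphi$ with $\varphi'(t)\nearrow\infty$ as $t\searrow0$ such that $$\langle u^*,u^\dagger-u\rangle\le\beta_1\mathcal D_{\mathcal R}^{u^*}(u,u^\dagger)+\beta_2\,\varphi(\mathcal T(g^\dagger;F(u)))\qquad\forall u\in\mathfrak B.$$ Define $\psi(t):=1/\varphi'(\varphi^{-1}(t))=(\varphi^{-1})'(t)$ for $t>0$, $\psi(0):=0$; $\varPsi(t):=\int_0^t\psi^{-1}(s)\,ds$ for $t\ge0$; and $$\Lambda:=\inf\{g:\sqrt g\text{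 is a concave index function, } g(t)\ge\varPsi(t)/t\text{ for }t\ge0\}$$ (pointwise infimum). For $n\ge1$ set $\Phi_{\rm nl}(n):=2\eta C_{\rm NL}\,\mathcal T(g^\dagger;F(u_{n-1}))/\alpha_{n-1}$ with $C_{\rm NL}:=\max\{2C_{\rm err},C_{\rm err}+1/C_{\rm err}\}$, $\Phi_{\rm app}(n):=2\beta_2\Lambda(\alpha_{n-1})$, $\Phi_{\rm noi}(n):=2\,\mathbf{err}/\alpha_{n-1}$, and $$\bar\gamma:=\frac{\eta C_{\rm dec}C_{\rm NL}}{\frac1{C_{\rm tc}C_{\rm err}}-\beta_2},\qquad\gamma_{\rm nl}:=\max\left\{\frac{C_{\rm dec}^2\bar\gamma}{1-C_{\rm dec}^2\bar\gamma},\frac{\Phi_{\rm nl}(1)}{\Phi_{\rm app}(1)+\Phi_{\rm noi}(1)}\right\}.$$ "Sufficiently small" means bounded above by positive thresholds determined by the other fixed quantities of the problem; $\mathcal O$-constants are independent of $n$ and, for noisy data, of $g^{\rm obs}$ and $\mathbf{err}$. *)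

theory Defs
  imports "HOL-Analysis.Analysis"
begin

(* Functionals with values in (-\<infinity>, \<infinity>] or [0, \<infinity>] are ereal-valued; in ereal 0 * \<infinity> = 0. *)

definition index_function :: "(real \<Rightarrow> real) \<Rightarrow> bool" where
  "index_function \<phi> \<longleftrightarrow>
     continuous_on {0..} \<phi> \<and> mono_on {0..} \<phi> \<and> \<phi> \<in> {0..} \<rightarrow> {0..} \<and> \<phi> 0 = 0"

definition strictly_concave_on :: "real set \<Rightarrow> (real \<Rightarrow> real) \<Rightarrow> bool" where
  "strictly_concave_on A \<phi> \<longleftrightarrow>
     (\<forall>x\<in>A. \<forall>y\<in>A. \<forall>t. x \<noteq> y \<and> 0 < t \<and> t < 1 \<longrightarrow>
        (1 - t) * \<phi> x + t * \<phi> y < \<phi> ((1 - t) * x + t * y))"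

(* Differentiability is required on (0, \<infinity>) only, the derivative being unbounded at 0.  That the
   divergence at 0 is monotone follows from concavity. *)
definition source_index_function :: "(real \<Rightarrow> real) \<Rightarrow> bool" where
  "source_index_function \<phi> \<longleftrightarrow>
     index_function \<phi> \<and> strictly_concave_on {0..} \<phi> \<and>
     (\<forall>t>0. \<phi> differentiable (at t)) \<and>
     filterlim (deriv \<phi>) at_top (at_right 0)"

(* Meaningful on the range of \<phi> only, where the inverse of \<phi> exists. *)
definition psi :: "(real \<Rightarrow> real) \<Rightarrow> real \<Rightarrow> real" where
  "psi \<phi> t = (if t = 0 then 0 else 1 / deriv \<phi> (the_inv_into {0..} \<phi> t))"

(* The range of psi is an interval starting at 0, possibly bounded.  The inverse is extended by
   \<infinity> to the right of that interval, in accordance with the monotonicity of psi. *)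
definition psi_inv :: "(real \<Rightarrow> real) \<Rightarrow> real \<Rightarrow> ennreal" where
  "psi_inv \<phi> s =
     (if s \<in> psi \<phi> ` \<phi> ` {0..} then ennreal (the_inv_into (\<phi> ` {0..}) (psi \<phi>) s) else \<infinity>)"

definition Psi :: "(real \<Rightarrow> real) \<Rightarrow> real \<Rightarrow> ereal" where
  "Psi \<phi> t = enn2ereal (\<integral>\<^sup>+ s\<in>{0..t}. psi_inv \<phi> s \<partial>lborel)"

definition Psi_inv :: "(real \<Rightarrow> real) \<Rightarrow> real \<Rightarrow> real" where
  "Psi_inv \<phi> e = the_inv_into {0..} (Psi \<phi>) (ereal e)"

(* At t = 0 the quotient is 0 / 0 = 0.  The value is \<infinity> if there is no admissible majorant. *)
definition Lam :: "(real \<Rightarrow> real) \<Rightarrow> real \<Rightarrow> ereal" where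
  "Lam \<phi> t =
     (INF g \<in> {g :: real \<Rightarrow> real.
                 index_function (\<lambda>s. sqrt (g s)) \<and> concave_on {0..} (\<lambda>s. sqrt (g s)) \<and>
                 (\<forall>s\<ge>0. Psi \<phi> s / ereal s \<le> ereal (g s))}. ereal (g t))"

definition first_variation ::
  "('x::real_normed_vector \<Rightarrow> 'y::real_normed_vector) \<Rightarrow> 'x \<Rightarrow> 'x \<Rightarrow> 'y" where
  "first_variation F u h = Lim (at_right 0) (\<lambda>t::real. (1 / t) *\<^sub>R (F (u + t *\<^sub>R h) - F u))"

definition forward_operator :: "'x::banach set \<Rightarrow> ('x \<Rightarrow> 'y::banach) \<Rightarrow> bool" where
  "forward_operator B F \<longleftrightarrow>
     convex B \<and> inj_on F B \<and> continuous_on B F \<and>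
     (\<forall>u\<in>B. \<forall>v\<in>B. \<exists>l. ((\<lambda>t::real. (1 / t) *\<^sub>R (F (u + t *\<^sub>R (v - u)) - F u)) \<longlongrightarrow> l) (at_right 0)) \<and>
     (\<forall>u\<in>B. \<exists>A :: 'x \<Rightarrow>\<^sub>L 'y. \<forall>v\<in>B. blinfun_apply A (v - u) = first_variation F u (v - u))"

abbreviation linearized ::
  "('x::real_normed_vector \<Rightarrow> 'y::real_normed_vector) \<Rightarrow> 'x \<Rightarrow> 'x \<Rightarrow> 'y" where
  "linearized F u v \<equiv> F u + first_variation F u (v - u)"

definition proper_convex :: "('x::real_vector \<Rightarrow> ereal) \<Rightarrow> bool" where
  "proper_convex R \<longleftrightarrow>
     (\<forall>u. R u \<noteq> -\<infinity>) \<and> (\<exists>u. R u < \<infinity>) \<and>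
     (\<forall>u v. \<forall>t\<in>{0..1}. R ((1 - t) *\<^sub>R u + t *\<^sub>R v) \<le> ereal (1 - t) * R u + ereal t * R v)"

definition subdifferential :: "('x::real_normed_vector \<Rightarrow> ereal) \<Rightarrow> 'x \<Rightarrow> ('x \<Rightarrow>\<^sub>L real) set" where
  "subdifferential R u =
     {us. \<bar>R u\<bar> \<noteq> \<infinity> \<and> (\<forall>v. R u + ereal (blinfun_apply us (v - u)) \<le> R v)}"

definition bregman ::
  "('x::real_normed_vector \<Rightarrow> ereal) \<Rightarrow> ('x \<Rightarrow>\<^sub>L real) \<Rightarrow> 'x \<Rightarrow> 'x \<Rightarrow> ereal" where
  "bregman R us u v = R u - R v - ereal (blinfun_apply us (u - v))"

(* No condition is imposed where the misfit is infinite, i.e. \<phi>(\<infinity>) = \<infinity>. *)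
definition additive_vsc ::
  "'x::real_normed_vector set \<Rightarrow> ('x \<Rightarrow> 'y) \<Rightarrow> ('x \<Rightarrow> ereal) \<Rightarrow> ('y \<Rightarrow> 'y \<Rightarrow> ereal) \<Rightarrow> 'x \<Rightarrow>
   ('x \<Rightarrow>\<^sub>L real) \<Rightarrow> real \<Rightarrow> real \<Rightarrow> (real \<Rightarrow> real) \<Rightarrow> bool" where
  "additive_vsc B F R T ud us \<beta>\<^sub>1 \<beta>\<^sub>2 \<phi> \<longleftrightarrow>
     us \<in> subdifferential R ud \<and>
     (\<forall>u\<in>B. T (F ud) (F u) < \<infinity> \<longrightarrow>
        ereal (blinfun_apply us (ud - u))
          \<le> ereal \<beta>\<^sub>1 * bregman R us u ud + ereal (\<beta>\<^sub>2 * \<phi> (real_of_ereal (T (F ud) (F u)))))"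

(* T is total, but only its values on F(B) x Y are constrained. *)
definition data_functionals ::
  "'x set \<Rightarrow> ('x \<Rightarrow> 'y) \<Rightarrow> 'x \<Rightarrow> ('y \<Rightarrow> 'y \<Rightarrow> ereal) \<Rightarrow> 'o set \<Rightarrow> ('o \<Rightarrow> 'y \<Rightarrow> ereal) \<Rightarrow> bool" where
  "data_functionals B F ud T Yobs S \<longleftrightarrow>
     ud \<in> B \<and>
     (\<forall>g\<in>F ` B. \<forall>h. 0 \<le> T g h) \<and> T (F ud) (F ud) = 0 \<and>
     (\<forall>gobs\<in>Yobs. \<forall>h. S gobs h \<noteq> -\<infinity>)"

definition error_bound ::
  "real \<Rightarrow> ('y \<Rightarrow> 'y \<Rightarrow> ereal) \<Rightarrow> ('o \<Rightarrow> 'y \<Rightarrow> ereal) \<Rightarrow> 'y \<Rightarrow> 'o \<Rightarrow> ('y \<Rightarrow> ereal) \<Rightarrow> bool" where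
  "error_bound C_err T S gd gobs err \<longleftrightarrow>
     (\<forall>g. 0 \<le> err g \<and>
          S gobs g \<le> ereal C_err * T gd g + ereal C_err * err g \<and>
          T gd g \<le> ereal C_err * S gobs g + ereal C_err * err g)"

datatype cone_type = TypeA | TypeB

(* In the lower bounds the term with -\<eta> is moved to the other side, so that no difference
   \<infinity> - \<infinity> occurs. *)
definition cone_estimate ::
  "real \<Rightarrow> real \<Rightarrow> 'x::real_normed_vector set \<Rightarrow> ('x \<Rightarrow> 'y::real_normed_vector) \<Rightarrow> ('y \<Rightarrow> ereal) \<Rightarrow> bool" where
  "cone_estimate \<eta> C_tc B F G \<longleftrightarrow>
     (\<forall>u\<in>B. \<forall>v\<in>B.
        ereal (1 / C_tc) * G (F v) \<le> G (linearized F u v) + ereal \<eta> * G (F u) \<and>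
        G (linearized F u v) \<le> ereal C_tc * G (F v) + ereal \<eta> * G (F u))"

fun tangential_cone ::
  "cone_type \<Rightarrow> real \<Rightarrow> real \<Rightarrow> 'x::real_normed_vector set \<Rightarrow> ('x \<Rightarrow> 'y::real_normed_vector) \<Rightarrow> 'x \<Rightarrow>
   ('y \<Rightarrow> 'y \<Rightarrow> ereal) \<Rightarrow> 'o set \<Rightarrow> ('o \<Rightarrow> 'y \<Rightarrow> ereal) \<Rightarrow> bool" where
  "tangential_cone TypeA \<eta> C_tc B F ud T Yobs S \<longleftrightarrow>
     (\<forall>gobs\<in>Yobs. cone_estimate \<eta> C_tc B F (S gobs))"
| "tangential_cone TypeB \<eta> C_tc B F ud T Yobs S \<longleftrightarrow>
     cone_estimate \<eta> C_tc B F (T (F ud))"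

fun err_term ::
  "cone_type \<Rightarrow> real \<Rightarrow> real \<Rightarrow> real \<Rightarrow> ('x::real_normed_vector \<Rightarrow> 'y::real_normed_vector) \<Rightarrow> 'x \<Rightarrow>
   ('y \<Rightarrow> ereal) \<Rightarrow> (nat \<Rightarrow> 'x) \<Rightarrow> nat \<Rightarrow> ereal" where
  "err_term TypeA C_err C_tc \<eta> F ud err u n =
     ereal (1 / C_tc) * err (F (u (Suc n))) + ereal (2 * \<eta> * C_err) * err (F (u n))
       + ereal (C_tc * C_err) * err (F ud)"
| "err_term TypeB C_err C_tc \<eta> F ud err u n =
     err (linearized F (u n) (u (Suc n))) + ereal C_err * err (linearized F (u n) ud)"

definition regularization_parameters :: "real \<Rightarrow> (nat \<Rightarrow> real) \<Rightarrow> bool" where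
  "regularization_parameters C_dec \<alpha> \<longleftrightarrow>
     (\<forall>n. 0 < \<alpha> n) \<and> \<alpha> 0 \<le> 1 \<and> \<alpha> \<longlonglongrightarrow> 0 \<and>
     (\<forall>n. 1 \<le> \<alpha> n / \<alpha> (Suc n) \<and> \<alpha> n / \<alpha> (Suc n) \<le> C_dec)"

definition newton_iterates ::
  "'x::real_normed_vector set \<Rightarrow> ('x \<Rightarrow> 'y::real_normed_vector) \<Rightarrow> ('x \<Rightarrow> ereal) \<Rightarrow> ('o \<Rightarrow> 'y \<Rightarrow> ereal) \<Rightarrow>
   (nat \<Rightarrow> real) \<Rightarrow> 'o \<Rightarrow> 'x \<Rightarrow> (nat \<Rightarrow> 'x) \<Rightarrow> bool" where
  "newton_iterates B F R S \<alpha> gobs u\<^sub>0 u \<longleftrightarrow>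
     u 0 = u\<^sub>0 \<and>
     (\<forall>n. is_arg_min (\<lambda>v. S gobs (linearized F (u n) v) + ereal (\<alpha> n) * R v) (\<lambda>v. v \<in> B) (u (Suc n)))"

definition C_NL :: "real \<Rightarrow> real" where
  "C_NL C_err = max (2 * C_err) (C_err + 1 / C_err)"

(* The three error components are meant for n \<ge> 1.  In Phi_nl, the function \<tau> stands for
   u \<mapsto> T(g\<dagger>; F(u)). *)
definition Phi_nl :: "real \<Rightarrow> real \<Rightarrow> ('x \<Rightarrow> ereal) \<Rightarrow> (nat \<Rightarrow> real) \<Rightarrow> (nat \<Rightarrow> 'x) \<Rightarrow> nat \<Rightarrow> ereal" where
  "Phi_nl \<eta> C_err \<tau> \<alpha> u n = ereal (2 * \<eta> * C_NL C_err) * \<tau> (u (n - 1)) / ereal (\<alpha> (n - 1))"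

definition Phi_app :: "real \<Rightarrow> (real \<Rightarrow> real) \<Rightarrow> (nat \<Rightarrow> real) \<Rightarrow> nat \<Rightarrow> ereal" where
  "Phi_app \<beta>\<^sub>2 \<phi> \<alpha> n = ereal (2 * \<beta>\<^sub>2) * Lam \<phi> (\<alpha> (n - 1))"

definition Phi_noi :: "real \<Rightarrow> (nat \<Rightarrow> real) \<Rightarrow> nat \<Rightarrow> real" where
  "Phi_noi e \<alpha> n = 2 * e / \<alpha> (n - 1)"

definition gamma_bar :: "real \<Rightarrow> real \<Rightarrow> real \<Rightarrow> real \<Rightarrow> real \<Rightarrow> real" where
  "gamma_bar C_err C_tc C_dec \<eta> \<beta>\<^sub>2 = \<eta> * C_dec * C_NL C_err / (1 / (C_tc * C_err) - \<beta>\<^sub>2)"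

definition gamma_nl ::
  "real \<Rightarrow> real \<Rightarrow> real \<Rightarrow> real \<Rightarrow> real \<Rightarrow> (real \<Rightarrow> real) \<Rightarrow> (nat \<Rightarrow> real) \<Rightarrow> ('x \<Rightarrow> ereal) \<Rightarrow> real \<Rightarrow>
   (nat \<Rightarrow> 'x) \<Rightarrow> ereal" where
  "gamma_nl C_err C_tc C_dec \<eta> \<beta>\<^sub>2 \<phi> \<alpha> \<tau> e u =
     (let \<gamma> = gamma_bar C_err C_tc C_dec \<eta> \<beta>\<^sub>2 in
      max (ereal (C_dec\<^sup>2 * \<gamma> / (1 - C_dec\<^sup>2 * \<gamma>)))
          (Phi_nl \<eta> C_err \<tau> \<alpha> u 1 / (Phi_app \<beta>\<^sub>2 \<phi> \<alpha> 1 + ereal (Phi_noi e \<alpha> 1))))"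

definition n_star :: "(real \<Rightarrow> real) \<Rightarrow> (nat \<Rightarrow> real) \<Rightarrow> real \<Rightarrow> nat" where
  "n_star \<phi> \<alpha> e = (LEAST n. Psi \<phi> (\<alpha> n) \<le> ereal e)"

definition N_max :: "real \<Rightarrow> real \<Rightarrow> (nat \<Rightarrow> real) \<Rightarrow> real \<Rightarrow> nat" where
  "N_max C_bd q \<alpha> e = (LEAST n. 1 \<le> n \<and> 1 \<le> C_bd powr (1 / q) * Phi_noi e \<alpha> n powr (1 / q))"

definition n_bal ::
  "real \<Rightarrow> real \<Rightarrow> (nat \<Rightarrow> real) \<Rightarrow> real \<Rightarrow> ereal \<Rightarrow> (nat \<Rightarrow> 'x::real_normed_vector) \<Rightarrow> nat" where
  "n_bal C_bd q \<alpha> e c u =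
     (LEAST n. n \<in> {1..N_max C_bd q \<alpha> e} \<and>
        (\<forall>m\<ge>n. ereal (norm (u n - u m)) \<le> c * ereal (Phi_noi e \<alpha> m powr (1 / q))))"

end

theory Submission
  imports Defs
begin

text \<open>Comparing the minimizer \<open>u\<^bsub>n+1\<^esub>\<close> with the exact solution gives a bound for the Bregman distance
\<open>D\<^bsub>n+1\<^esub>\<close> by three contributions: a nonlinearity term proportional to \<open>\<eta> \<tau>\<^sub>n / \<alpha>\<^sub>n\<close> with
\<open>\<tau>\<^sub>n = T(g\<dagger>; F(u\<^sub>n))\<close>, the noise term \<open>err / \<alpha>\<^sub>n\<close>, and the term \<open>\<beta>\<^sub>2 \<phi>(\<tau>\<^bsub>n+1\<^esub>)\<close> of the source condition.
The same estimate contains a gain \<open>- \<tau>\<^bsub>n+1\<^esub> / (C_tc C_err \<alpha>\<^sub>n)\<close>, which comes from the lower bound in the cone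
condition.  Three observations turn this into rates.

First, \<open>Psi\<close> is the convex conjugate of the inverse of \<open>\<phi>\<close>, so Young's inequality
\<open>\<phi>(\<tau>) \<le> \<tau> / \<alpha> + Psi(\<alpha>) / \<alpha> \<le> \<tau> / \<alpha> + \<Lambda>(\<alpha>)\<close> lets the gain absorb the unknown
\<open>\<tau>\<^bsub>n+1\<^esub>\<close> in the source condition as soon as \<open>\<beta>\<^sub>2 < 1 / (C_tc C_err)\<close>; what remains is the
approximation error \<open>\<beta>\<^sub>2 \<Lambda>(\<alpha>\<^sub>n)\<close> (lemmas \<open>Psi_eq_conjugate\<close>, \<open>young\<close>,
\<open>error_decomposition\<close>).

Secondly, \<open>\<Lambda>\<close> is an infimum of squares of concave functions, whence
\<open>\<Lambda>(C t) \<le> C\<^sup>2 \<Lambda>(t)\<close>.  As \<open>\<alpha>\<close> decays at most geometrically, the approximation error and the noise error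
change by at most the factor \<open>C_dec\<^sup>2\<close> per step, while the nonlinearity error after a step is at most a
multiple, proportional to \<open>\<eta>\<close>, of the total error before it.  For small \<open>\<eta>\<close> it therefore stays a bounded multiple \<open>\<gamma>\<close> of the other two
(\<open>nl_error_le\<close>), and \<open>D_le\<close> bounds the total error by approximation error plus noise error.

Thirdly, the approximation error decreases and the noise error increases with \<open>n\<close>, and at
\<open>\<alpha> = Psi\<^sup>-\<^sup>1(err)\<close> the noise term \<open>err / \<alpha> = Psi(\<alpha>) / \<alpha>\<close> is at most \<open>\<Lambda>(\<alpha>)\<close>, so that \<open>\<Lambda>(\<alpha>)\<close> governs
both there.  The a priori rule stops within one step of
this point (\<open>a_priori_rate\<close>).  The balancing rule never stops after the first index at which the noise error
dominates, and by its definition the iterate where it stops is as close to the one at that index as the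
noise error there permits (\<open>lepskij_rate\<close>).

If no admissible majorant of \<open>Psi(t) / t\<close> exists, then \<open>\<Lambda>\<close> is infinite and all bounds are trivial; otherwise
\<open>Psi\<close> is finite everywhere, and this is what makes \<open>psi\<close> onto \<open>[0, \<infinity>)\<close> and \<open>Psi\<close> a finite conjugate.\<close>

section \<open>The conjugate of the inverse index function\<close>

locale index_source =
  fixes \<phi> :: "real \<Rightarrow> real"
  assumes source: "source_index_function \<phi>"
begin

lemma phi_mono: "0 \<le> s \<Longrightarrow> s \<le> t \<Longrightarrow> \<phi> s \<le> \<phi> t"
  using source by (auto simp: source_index_function_def index_function_def mono_on_def)

lemma phi_zero: "\<phi> 0 = 0"
  using source by (auto simp: source_index_function_def index_function_def)

lemma phi_nonneg: "0 \<le> t \<Longrightarrow> 0 \<le> \<phi> t"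
  using phi_mono[of 0 t] phi_zero by simp

lemma phi_continuous: "continuous_on {0..} \<phi>"
  using source by (auto simp: source_index_function_def index_function_def)

lemma phi_deriv: "0 < t \<Longrightarrow> (\<phi> has_real_derivative deriv \<phi> t) (at t)"
  using source by (auto simp: source_index_function_def DERIV_deriv_iff_real_differentiable)

lemma phi_concave: "concave_on {0..} \<phi>"
  unfolding concave_on_iff
proof (intro conjI ballI allI impI)
  fix x y u v :: real
  assume xy: "x \<in> {0..}" "y \<in> {0..}" and uv: "0 \<le> u" "0 \<le> v" "u + v = 1"
  have strict: "strictly_concave_on {0..} \<phi>"
    using source by (simp add: source_index_function_def)
  have u: "u = 1 - v" using uv by simp
  show "u * \<phi> x + v * \<phi> y \<le> \<phi> (u *\<^sub>R x + v *\<^sub>R y)"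
  proof (cases "x = y \<or> v = 0 \<or> u = 0")
    case True
    then show ?thesis using u by (auto simp flip: distrib_right)
  next
    case False
    then have "(1 - v) * \<phi> x + v * \<phi> y < \<phi> ((1 - v) * x + v * y)"
      using strict xy uv unfolding strictly_concave_on_def by simp
    then show ?thesis using u by simp
  qed
qed simp

text \<open>The weak inequality is the tangent inequality for concave functions; applied at the midpoint of \<open>r\<close> and \<open>t\<close>,
where strict concavity puts \<open>\<phi>\<close> above the chord, it becomes strict at \<open>r\<close>.\<close>

lemma below_tangent:
  assumes "0 < t" "0 \<le> r" "r \<noteq> t"
  shows "\<phi> r < \<phi> t + deriv \<phi> t * (r - t)"
proof -
  define m where "m = (1 - 1/2) * r + 1/2 * t"
  have m: "m - t = (r - t) / 2" "0 \<le> m"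
    using assms by (auto simp: m_def field_simps)
  have strict: "strictly_concave_on {0..} \<phi>"
    using source by (simp add: source_index_function_def)
  have "- \<phi> m - - \<phi> t \<ge> - deriv \<phi> t * (m - t)"
  proof (rule convex_on_imp_above_tangent[where A = "{0..}"])
    show "convex_on {0..} (\<lambda>x. - \<phi> x)" using phi_concave by (simp add: concave_on_def)
    show "((\<lambda>x. - \<phi> x) has_real_derivative - deriv \<phi> t) (at t within {0..})"
      by (intro DERIV_minus DERIV_subset[OF phi_deriv]) (use assms in auto)
  qed (use assms m in \<open>auto simp: interior_real_atLeast\<close>)
  moreover have "(1 - 1/2) * \<phi> r + 1/2 * \<phi> t < \<phi> m"
    unfolding m_def
    by (rule strict[unfolded strictly_concave_on_def, rule_format]) (use assms in auto)
  ultimately show ?thesis using m(1) by (simp add: field_simps)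
qed

lemma deriv_pos: "0 < t \<Longrightarrow> 0 < deriv \<phi> t"
  using below_tangent[of t "t + 1"] phi_mono[of t "t + 1"] by simp

lemma phi_strict_mono:
  assumes "0 \<le> s" "s < t" shows "\<phi> s < \<phi> t"
proof -
  have "deriv \<phi> t * (s - t) < 0"
    using deriv_pos[of t] assms by (simp add: mult_pos_neg)
  then show ?thesis using below_tangent[of t s] assms by linarith
qed

lemma phi_inj: "inj_on \<phi> {0..}"
  by (rule inj_onI) (metis atLeast_iff linorder_less_linear phi_strict_mono less_irrefl)

lemma phi_pos: "0 < t \<Longrightarrow> 0 < \<phi> t"
  using phi_strict_mono[of 0 t] phi_zero by simp

lemma deriv_strict_antimono:
  assumes "0 < s" "s < t" shows "deriv \<phi> t < deriv \<phi> s"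
proof -
  have "(deriv \<phi> t - deriv \<phi> s) * (t - s) < 0"
    using below_tangent[of t s] below_tangent[of s t] assms by (simp add: algebra_simps)
  then show ?thesis using assms by (simp add: mult_less_0_iff)
qed

lemma psi_phi: "0 \<le> t \<Longrightarrow> psi \<phi> (\<phi> t) = (if t = 0 then 0 else 1 / deriv \<phi> t)"
  using phi_pos[of t] phi_zero the_inv_into_f_f[OF phi_inj, of t] by (auto simp: psi_def)

lemma psi_inj: "inj_on (psi \<phi>) (\<phi> ` {0..})"
proof (rule inj_onI)
  fix x y assume "x \<in> \<phi> ` {0..}" "y \<in> \<phi> ` {0..}" and eq: "psi \<phi> x = psi \<phi> y"
  then obtain s t where st: "x = \<phi> s" "y = \<phi> t" "0 \<le> s" "0 \<le> t" by auto
  have "s = t"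
    using eq st deriv_pos[of s] deriv_pos[of t] deriv_strict_antimono[of s t] deriv_strict_antimono[of t s]
    by (cases s t rule: linorder_cases) (auto simp: psi_phi split: if_splits)
  then show "x = y" using st by simp
qed

lemma psi_inv_psi: "0 \<le> t \<Longrightarrow> psi_inv \<phi> (psi \<phi> (\<phi> t)) = ennreal (\<phi> t)"
  using the_inv_into_f_f[OF psi_inj, of "\<phi> t"] by (auto simp: psi_inv_def)

end

text \<open>Beyond the supremum of the range of \<open>psi\<close> the function \<open>psi_inv\<close> is infinite, and so is \<open>Psi\<close>.
Finiteness of \<open>Psi\<close> thus expresses that the slopes of \<open>\<phi>\<close> come arbitrarily close to zero.\<close>

locale finite_conjugate = index_source +
  assumes Psi_finite: "\<And>t. 0 \<le> t \<Longrightarrow> Psi \<phi> t \<noteq> \<infinity>"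
begin

lemma psi_unbounded:
  assumes "0 < s" shows "\<exists>T>0. deriv \<phi> T \<le> 1 / s"
proof (rule ccontr)
  assume no: "\<not> (\<exists>T>0. deriv \<phi> T \<le> 1 / s)"
  have top: "psi_inv \<phi> r = top" if "s \<le> r" for r
  proof -
    have "r \<notin> psi \<phi> ` \<phi> ` {0..}"
    proof
      assume "r \<in> psi \<phi> ` \<phi> ` {0..}"
      then obtain T where T: "0 \<le> T" "r = psi \<phi> (\<phi> T)" by auto
      then have "0 < T" "r = 1 / deriv \<phi> T"
        using assms that by (auto simp: psi_phi split: if_splits)
      moreover have "1 / s < deriv \<phi> T" using no \<open>0 < T\<close> by auto
      ultimately have "r * deriv \<phi> T < s * deriv \<phi> T"
        using assms deriv_pos[of T] by (simp add: field_simps)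
      then have "r < s" using deriv_pos[OF \<open>0 < T\<close>] by simp
      with that show False by simp
    qed
    then show ?thesis by (simp add: psi_inv_def infinity_ennreal_def)
  qed
  have "(\<integral>\<^sup>+ r. top * indicator {s..s+1} r \<partial>lborel) \<le> (\<integral>\<^sup>+ r\<in>{0..s+1}. psi_inv \<phi> r \<partial>lborel)"
    using assms by (intro nn_integral_mono) (auto simp: top indicator_def)
  moreover have "(\<integral>\<^sup>+ r. top * indicator {s..s+1} r \<partial>(lborel::real measure)) = top"
    by (subst nn_integral_cmult_indicator) (auto simp: ennreal_top_mult)
  ultimately have "Psi \<phi> (s + 1) = \<infinity>"
    by (simp add: Psi_def top_unique)
  then show False using Psi_finite[of "s+1"] assms by simp
qed

text \<open>A point with slope \<open>1 / s\<close> is an interior maximizer of \<open>r \<mapsto> s \<phi>(r) - r\<close> on \<open>[0, T]\<close>, where \<open>T\<close> is a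
point of smaller slope.  The unbounded derivative at \<open>0\<close> excludes the left endpoint, the slope at \<open>T\<close> the
right one.\<close>

lemma deriv_surj:
  assumes s: "0 < s" shows "\<exists>t>0. deriv \<phi> t = 1 / s"
proof -
  obtain T where T: "0 < T" "deriv \<phi> T \<le> 1 / s" using psi_unbounded[OF s] by blast
  define f where "f r = s * \<phi> r - r" for r
  have df: "(f has_real_derivative s * deriv \<phi> t - 1) (at t)" if "0 < t" for t
    unfolding f_def using phi_deriv[OF that] by (auto intro!: derivative_eq_intros)
  have "continuous_on {0..T} f"
    unfolding f_def by (intro continuous_intros continuous_on_subset[OF phi_continuous]) auto
  then obtain t where t: "t \<in> {0..T}" and max: "\<And>r. r \<in> {0..T} \<Longrightarrow> f r \<le> f t"
    using continuous_attains_sup[of "{0..T}" f] T by auto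
  show ?thesis
  proof (cases "deriv \<phi> T = 1 / s")
    case True
    then show ?thesis using T by blast
  next
    case False
    have "eventually (\<lambda>r. 1 / s < deriv \<phi> r) (at_right 0)"
      using source unfolding source_index_function_def filterlim_at_top_dense by blast
    then obtain b where b: "0 < b" "\<And>r. 0 < r \<Longrightarrow> r < b \<Longrightarrow> 1 / s < deriv \<phi> r"
      unfolding eventually_at_right_field by auto
    define r where "r = min (b / 2) T"
    have r: "0 < r" "r < b" "r \<le> T" using b T by (auto simp: r_def)
    have "1 < s * deriv \<phi> r" using b(2)[OF r(1,2)] s by (simp add: field_simps)
    then have "r * 1 < r * (s * deriv \<phi> r)" using r by (intro mult_strict_left_mono) auto
    moreover have "s * (deriv \<phi> r * r) < s * \<phi> r"
      using below_tangent[of r 0] r s phi_zero by (intro mult_strict_left_mono) auto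
    ultimately have "0 < f r" by (simp add: f_def algebra_simps)
    then have t0: "t \<noteq> 0" using max[of r] r by (auto simp: f_def phi_zero)
    have "s * deriv \<phi> T - 1 < 0" using False T s by (simp add: field_simps)
    then obtain d where d: "0 < d" "\<And>h. 0 < h \<Longrightarrow> h < d \<Longrightarrow> f T < f (T - h)"
      using DERIV_neg_dec_left[OF df[OF T(1)]] by auto
    define h where "h = min (d / 2) (T / 2)"
    have h: "0 < h" "h < d" "h < T" using d T by (auto simp: h_def)
    have tT: "t \<noteq> T" using d(2)[OF h(1,2)] max[of "T - h"] h by auto
    have t': "0 < t" "t < T" using t t0 tT by auto
    have "s * deriv \<phi> t - 1 = 0"
    proof (rule DERIV_local_max[OF df[OF t'(1)]])
      show "0 < min t (T - t)" using t' by simp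
      show "\<forall>y. \<bar>t - y\<bar> < min t (T - t) \<longrightarrow> f y \<le> f t" using max by (auto simp: abs_if split: if_splits)
    qed
    then show ?thesis using t' s by (auto simp: field_simps)
  qed
qed

text \<open>The point where the line of slope \<open>1 / s\<close> touches the graph of \<open>\<phi>\<close>, i.e. the maximizer of
\<open>t \<mapsto> s \<phi>(t) - t\<close>, continued by \<open>0\<close>.  In terms of it, \<open>psi_inv s = \<phi> (contact s)\<close>.\<close>

definition contact :: "real \<Rightarrow> real" where
  "contact s = (if s \<le> 0 then 0 else SOME t. 0 < t \<and> deriv \<phi> t = 1 / s)"

lemma contact_pos: "0 < s \<Longrightarrow> 0 < contact s"
  and deriv_contact: "0 < s \<Longrightarrow> deriv \<phi> (contact s) = 1 / s"
  using someI_ex[OF deriv_surj[of s, unfolded Bex_def]] by (auto simp: contact_def)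

lemma contact_zero: "contact 0 = 0"
  by (simp add: contact_def)

lemma contact_nonneg: "0 \<le> contact s"
  using contact_pos[of s] by (cases "0 < s") (auto simp: contact_def)

lemma contact_mono: "0 \<le> s \<Longrightarrow> s \<le> t \<Longrightarrow> contact s \<le> contact t"
proof (cases "s = 0 \<or> s = t")
  case False
  assume "0 \<le> s" "s \<le> t"
  with False have st: "0 < s" "s < t" by auto
  then have "deriv \<phi> (contact t) < deriv \<phi> (contact s)"
    by (simp add: deriv_contact field_simps)
  then show ?thesis
    using deriv_strict_antimono[of "contact t" "contact s"] contact_pos st by fastforce
qed (auto simp: contact_zero contact_nonneg)

lemma contact_deriv: "0 < t \<Longrightarrow> contact (1 / deriv \<phi> t) = t"
  using deriv_contact[of "1 / deriv \<phi> t"] contact_pos[of "1 / deriv \<phi> t"] deriv_pos[of t]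
    deriv_strict_antimono[of t "contact (1 / deriv \<phi> t)"] deriv_strict_antimono[of "contact (1 / deriv \<phi> t)" t]
  by (cases t "contact (1 / deriv \<phi> t)" rule: linorder_cases) auto

text \<open>A monotone map with an open image has no jumps, and every point of \<open>(0, \<infinity>)\<close> is the contact point of its own
tangent.\<close>

lemma contact_continuous: "continuous_on {0<..} contact"
proof (rule continuous_onI_mono)
  have "contact ` {0<..} = {0<..}"
  proof
    show "{0<..} \<subseteq> contact ` {0<..}"
    proof
      fix t :: real assume "t \<in> {0<..}"
      then show "t \<in> contact ` {0<..}"
        using contact_deriv[of t] deriv_pos[of t] by (intro image_eqI[of _ _ "1 / deriv \<phi> t"]) auto
    qed
  qed (auto simp: contact_pos)
  then show "open (contact ` {0<..})" by simp
qed (auto simp: contact_mono)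

text \<open>The value at \<open>s\<close> of the convex conjugate of the inverse of \<open>\<phi>\<close>, that is, the supremum of \<open>s \<phi>(t) - t\<close>
over \<open>t \<ge> 0\<close>, written through its maximizer.\<close>

definition conjugate :: "real \<Rightarrow> real" where
  "conjugate s = s * \<phi> (contact s) - contact s"

lemma conjugate_zero: "conjugate 0 = 0"
  by (simp add: conjugate_def contact_zero)

lemma conjugate_ge:
  assumes "0 \<le> s" "0 \<le> t" shows "s * \<phi> t - t \<le> conjugate s"
proof (cases "s = 0 \<or> t = contact s")
  case True
  then show ?thesis using assms by (auto simp: conjugate_zero, simp add: conjugate_def)
next
  case False
  then have "\<phi> t < \<phi> (contact s) + (1 / s) * (t - contact s)"
    using below_tangent[of "contact s" t] contact_pos[of s] assms by (simp add: deriv_contact)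
  then have "s * \<phi> t < s * (\<phi> (contact s) + (1 / s) * (t - contact s))"
    using False assms by (intro mult_strict_left_mono) auto
  then show ?thesis using False by (simp add: conjugate_def algebra_simps)
qed

lemma conjugate_subgradient:
  assumes "0 \<le> r" shows "conjugate s + \<phi> (contact s) * (r - s) \<le> conjugate r"
  using conjugate_ge[OF assms contact_nonneg[of s]] by (simp add: conjugate_def algebra_simps)

text \<open>By the subgradient inequality at both points, the difference quotient between \<open>r\<close> and \<open>s\<close> lies between
\<open>\<phi> (contact r)\<close> and \<open>\<phi> (contact s)\<close>; continuity of \<open>\<phi> \<circ> contact\<close> closes the gap.\<close>

lemma conjugate_deriv:
  assumes s: "0 < s" shows "(conjugate has_real_derivative \<phi> (contact s)) (at s)"
  unfolding has_field_derivative_iff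
proof -
  let ?p = "\<lambda>r. \<phi> (contact r)"
  let ?q = "\<lambda>r. (conjugate r - conjugate s) / (r - s)"
  have "continuous_on {0<..} ?p"
    by (rule continuous_on_compose2[OF phi_continuous contact_continuous]) (auto simp: contact_nonneg)
  then have "isCont ?p s" using s by (simp add: continuous_on_eq_continuous_at)
  then have lim: "(?p \<longlongrightarrow> ?p s) (at s)" by (simp add: isCont_def)
  have bound: "\<bar>?q r - ?p s\<bar> \<le> \<bar>?p r - ?p s\<bar>" if "0 < r" "r \<noteq> s" for r
  proof (cases "s < r")
    case True
    have "?p s \<le> ?q r" "?q r \<le> ?p r"
      using conjugate_subgradient[of r s] conjugate_subgradient[of s r] True s by (auto simp: field_simps)
    then show ?thesis by simp
  next
    case False
    then have "?q r \<le> ?p s" "?p r \<le> ?q r"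
      using conjugate_subgradient[of r s] conjugate_subgradient[of s r] that s
      by (auto simp: divide_le_eq le_divide_eq algebra_simps)
    then show ?thesis by simp
  qed
  have "((\<lambda>r. ?q r - ?p s) \<longlongrightarrow> 0) (at s)"
  proof (rule Lim_null_comparison)
    show "\<forall>\<^sub>F r in at s. norm (?q r - ?p s) \<le> \<bar>?p r - ?p s\<bar>"
      unfolding eventually_at_topological
      by (intro exI[of _ "{0<..}"]) (use bound s in auto)
    show "((\<lambda>r. \<bar>?p r - ?p s\<bar>) \<longlongrightarrow> 0) (at s)"
      using lim by (auto intro!: tendsto_eq_intros)
  qed
  then show "(?q \<longlongrightarrow> ?p s) (at s)" by (simp add: Lim_null[of ?q])
qed

lemma conjugate_continuous: "continuous_on {0..} conjugate"
  unfolding continuous_on_def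
proof
  fix s :: real assume "s \<in> {0..}"
  show "(conjugate \<longlongrightarrow> conjugate s) (at s within {0..})"
  proof (cases "s = 0")
    case False
    then show ?thesis using DERIV_isCont[OF conjugate_deriv[of s]] \<open>s \<in> {0..}\<close>
      by (auto simp: isCont_def intro: tendsto_within_subset)
  next
    case True
    have "(conjugate \<longlongrightarrow> 0) (at 0 within {0..})"
    proof (rule Lim_null_comparison)
      show "\<forall>\<^sub>F r in at 0 within {0..}. norm (conjugate r) \<le> r * \<phi> (contact 1)"
        unfolding eventually_at
      proof (intro exI[of _ 1] conjI ballI impI)
        fix r :: real assume "r \<in> {0..}" "r \<noteq> 0 \<and> dist r 0 < 1"
        then have r: "0 < r" "r < 1" by auto
        have "r * \<phi> (contact r) \<le> r * \<phi> (contact 1)"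
          using r by (intro mult_left_mono phi_mono contact_mono contact_nonneg) auto
        then show "norm (conjugate r) \<le> r * \<phi> (contact 1)"
          using conjugate_ge[of r 0] r contact_nonneg[of r]
          unfolding phi_zero conjugate_def real_norm_def by linarith
      qed simp
      show "((\<lambda>r. r * \<phi> (contact 1)) \<longlongrightarrow> 0) (at 0 within {0..})"
        by (auto intro!: tendsto_eq_intros)
    qed
    then show ?thesis using True by (simp add: conjugate_zero)
  qed
qed

lemma conjugate_strict_mono:
  assumes "0 \<le> s" "s < t" shows "conjugate s < conjugate t"
proof -
  \<comment> \<open>The slope at \<open>s\<close> itself vanishes for \<open>s = 0\<close>, the slope at the midpoint does not.\<close>
  define m where "m = (s + t) / 2"
  have m: "s < m" "m < t" using assms by (auto simp: m_def)
  have "0 \<le> \<phi> (contact s) * (m - s)"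
    using m by (intro mult_nonneg_nonneg phi_nonneg contact_nonneg) auto
  moreover have "0 < \<phi> (contact m) * (t - m)"
    using m assms by (intro mult_pos_pos phi_pos contact_pos) auto
  ultimately show ?thesis
    using conjugate_subgradient[of m s] conjugate_subgradient[of t m] m assms by linarith
qed

text \<open>The conjugate vanishes at \<open>0\<close> and has derivative \<open>\<phi> (contact s) = psi_inv s\<close> for \<open>s > 0\<close>, hence is the
integral of \<open>psi_inv\<close>.\<close>

lemma Psi_eq_conjugate:
  assumes "0 \<le> t" shows "Psi \<phi> t = ereal (conjugate t)"
proof -
  have "((\<lambda>s. \<phi> (contact s)) has_integral conjugate t - conjugate 0) {0..t}"
  proof (rule fundamental_theorem_of_calculus_interior[OF assms])
    show "continuous_on {0..t} conjugate" by (rule continuous_on_subset[OF conjugate_continuous]) auto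
    show "(conjugate has_vector_derivative \<phi> (contact s)) (at s)" if "s \<in> {0<..<t}" for s
      using conjugate_deriv[of s] that by (simp add: has_real_derivative_iff_has_vector_derivative)
  qed
  then have "(\<integral>\<^sup>+ s\<in>{0..t}. ennreal (\<phi> (contact s)) \<partial>lborel) = ennreal (conjugate t)"
    by (intro nn_integral_has_integral_lebesgue') (auto simp: conjugate_zero phi_nonneg contact_nonneg)
  moreover have "psi_inv \<phi> s = ennreal (\<phi> (contact s))" if "0 \<le> s" for s
  proof -
    have "psi \<phi> (\<phi> (contact s)) = s"
      using that contact_pos[of s] deriv_contact[of s] contact_zero
      by (cases "s = 0") (auto simp: psi_phi contact_nonneg)
    then show ?thesis using psi_inv_psi[OF contact_nonneg[of s]] by simp
  qed
  then have "(\<integral>\<^sup>+ s\<in>{0..t}. psi_inv \<phi> s \<partial>lborel) = (\<integral>\<^sup>+ s\<in>{0..t}. ennreal (\<phi> (contact s)) \<partial>lborel)"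
    by (intro nn_integral_cong) (auto simp: indicator_def)
  ultimately show ?thesis
    using conjugate_ge[OF assms, of 0] by (simp add: Psi_def phi_zero)
qed

end

section \<open>The approximation rate\<close>

definition majorants :: "(real \<Rightarrow> real) \<Rightarrow> (real \<Rightarrow> real) set" where
  "majorants \<phi> = {g. index_function (\<lambda>s. sqrt (g s)) \<and> concave_on {0..} (\<lambda>s. sqrt (g s)) \<and>
     (\<forall>s\<ge>0. Psi \<phi> s / ereal s \<le> ereal (g s))}"

lemma Lam_eq_INF: "Lam \<phi> t = (INF g \<in> majorants \<phi>. ereal (g t))"
  by (simp add: Lam_def majorants_def)

lemma Lam_top: "majorants \<phi> = {} \<Longrightarrow> Lam \<phi> t = \<infinity>"
  by (simp add: Lam_eq_INF top_ereal_def)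

lemma majorant_mono: "g \<in> majorants \<phi> \<Longrightarrow> 0 \<le> s \<Longrightarrow> s \<le> t \<Longrightarrow> g s \<le> g t"
  unfolding majorants_def index_function_def mono_on_def by auto

lemma majorant_nonneg: "g \<in> majorants \<phi> \<Longrightarrow> 0 \<le> s \<Longrightarrow> 0 \<le> g s"
  unfolding majorants_def index_function_def by (auto simp: Pi_iff)

text \<open>A concave function \<open>f\<close> with \<open>f 0 = 0\<close> satisfies \<open>f (C t) \<le> C f t\<close> for \<open>C \<ge> 1\<close>; here \<open>f\<close> is the square root
of \<open>g\<close>.\<close>

lemma majorant_quadratic_growth:
  assumes g: "g \<in> majorants \<phi>" and C: "1 \<le> C" and t: "0 \<le> t"
  shows "g (C * t) \<le> C\<^sup>2 * g t"
proof -
  have conc: "concave_on {0..} (\<lambda>s. sqrt (g s))" and zero: "g 0 = 0"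
    using g by (auto simp: majorants_def index_function_def)
  have "(1 - 1 / C) * sqrt (g 0) + (1 / C) * sqrt (g (C * t))
      \<le> sqrt (g ((1 - 1 / C) *\<^sub>R 0 + (1 / C) *\<^sub>R (C * t)))"
    using C t by (intro concave_onD[OF conc]) auto
  then have "sqrt (g (C * t)) \<le> C * sqrt (g t)"
    using C zero by (simp add: field_simps)
  then have "(sqrt (g (C * t)))\<^sup>2 \<le> (C * sqrt (g t))\<^sup>2"
    using C t majorant_nonneg[OF g, of "C * t"] by (intro power_mono) auto
  then show ?thesis
    using C t majorant_nonneg[OF g, of "C * t"] majorant_nonneg[OF g, of t]
    by (simp add: power_mult_distrib)
qed

lemma majorant_small:
  assumes g: "g \<in> majorants \<phi>" and e: "0 < e"
  shows "\<exists>d>0. \<forall>t. 0 \<le> t \<and> t < d \<longrightarrow> g t < e"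
proof -
  have "continuous_on {0..} (\<lambda>s. sqrt (g s))" and zero: "g 0 = 0"
    using g by (auto simp: majorants_def index_function_def)
  then obtain d where d: "d > 0"
      "\<And>t. t \<in> {0..} \<Longrightarrow> dist t 0 < d \<Longrightarrow> dist (sqrt (g t)) (sqrt (g 0)) < sqrt e"
    unfolding continuous_on_iff using e by (metis atLeast_iff order_refl real_sqrt_gt_zero)
  then show ?thesis
    using zero majorant_nonneg[OF g] by (intro exI[of _ d]) (auto simp: dist_real_def)
qed

text \<open>One admissible majorant \<open>g0\<close> makes \<open>Lam\<close> finite and forces it to vanish at \<open>0\<close>.\<close>

locale finite_rate = index_source +
  fixes g0 :: "real \<Rightarrow> real"
  assumes g0: "g0 \<in> majorants \<phi>"

sublocale finite_rate \<subseteq> finite_conjugate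
proof
  fix t :: real assume t: "0 \<le> t"
  have "Psi \<phi> t / ereal t \<le> ereal (g0 t)" if "0 < t"
    using g0 that by (simp add: majorants_def)
  moreover have "Psi \<phi> 0 = 0"
  proof -
    have "(\<integral>\<^sup>+ s\<in>{0..0}. psi_inv \<phi> s \<partial>lborel) = 0"
      by (intro nn_integral_0_iff_AE[THEN iffD2] nn_integral_null_set) auto
    then show ?thesis by (simp add: Psi_def zero_ennreal.rep_eq)
  qed
  ultimately show "Psi \<phi> t \<noteq> \<infinity>"
    using t by (cases "t = 0") auto
qed

context finite_rate
begin

definition rate :: "real \<Rightarrow> real" where
  "rate t = real_of_ereal (Lam \<phi> t)"

lemma Lam_eq_rate: "0 \<le> t \<Longrightarrow> Lam \<phi> t = ereal (rate t)"
proof -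
  assume t: "0 \<le> t"
  have "0 \<le> Lam \<phi> t" unfolding Lam_eq_INF
    by (rule INF_greatest) (simp add: majorant_nonneg t)
  moreover have "Lam \<phi> t \<le> ereal (g0 t)"
    unfolding Lam_eq_INF by (rule INF_lower[OF g0])
  ultimately show ?thesis by (cases "Lam \<phi> t") (auto simp: rate_def)
qed

lemma rate_le: "g \<in> majorants \<phi> \<Longrightarrow> 0 \<le> t \<Longrightarrow> rate t \<le> g t"
  using INF_lower[of g "majorants \<phi>" "\<lambda>g. ereal (g t)"] Lam_eq_rate[of t]
  by (simp add: Lam_eq_INF)

lemma rate_greatest:
  assumes "0 \<le> t" "\<And>g. g \<in> majorants \<phi> \<Longrightarrow> c \<le> g t" shows "c \<le> rate t"
proof -
  have "ereal c \<le> Lam \<phi> t" unfolding Lam_eq_INF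
    by (rule INF_greatest) (simp add: assms)
  then show ?thesis using Lam_eq_rate[OF assms(1)] by simp
qed

lemma rate_nonneg: "0 \<le> t \<Longrightarrow> 0 \<le> rate t"
  by (rule rate_greatest) (auto simp: majorant_nonneg)

lemma rate_mono: "0 \<le> s \<Longrightarrow> s \<le> t \<Longrightarrow> rate s \<le> rate t"
  by (rule rate_greatest) (auto intro: order.trans[OF rate_le majorant_mono])

lemma rate_quadratic_growth:
  assumes "1 \<le> C" "0 \<le> t" shows "rate (C * t) \<le> C\<^sup>2 * rate t"
proof -
  have "rate (C * t) / C\<^sup>2 \<le> rate t"
  proof (rule rate_greatest[OF assms(2)])
    fix g assume g: "g \<in> majorants \<phi>"
    have "rate (C * t) \<le> C\<^sup>2 * g t"
      using rate_le[OF g, of "C * t"] majorant_quadratic_growth[OF g assms] assms by simp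
    then show "rate (C * t) / C\<^sup>2 \<le> g t" using assms by (simp add: field_simps)
  qed
  then show ?thesis using assms by (simp add: field_simps)
qed

lemma rate_le_quadratic:
  assumes "1 \<le> C" "0 \<le> s" "0 \<le> t" "s \<le> C * t" shows "rate s \<le> C\<^sup>2 * rate t"
  using rate_mono[OF assms(2,4)] rate_quadratic_growth[OF assms(1,3)] by simp

lemma conjugate_le_rate:
  assumes "0 < t" shows "conjugate t \<le> t * rate t"
proof -
  have "conjugate t / t \<le> rate t"
  proof (rule rate_greatest)
    fix g assume "g \<in> majorants \<phi>"
    then have "Psi \<phi> t / ereal t \<le> ereal (g t)" using assms by (simp add: majorants_def)
    then show "conjugate t / t \<le> g t" using assms by (simp add: Psi_eq_conjugate)
  qed (use assms in simp)
  then show ?thesis using assms by (simp add: field_simps)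
qed

lemma conjugate_pos: "0 < t \<Longrightarrow> 0 < conjugate t"
  using conjugate_strict_mono[of 0 t] conjugate_zero by simp

lemma rate_pos: "0 < t \<Longrightarrow> 0 < rate t"
  using conjugate_le_rate[of t] conjugate_pos[of t] by (metis less_le_trans zero_less_mult_pos)

lemma rate_small: "0 < e \<Longrightarrow> \<exists>d>0. \<forall>t. 0 \<le> t \<and> t < d \<longrightarrow> rate t < e"
  using majorant_small[OF g0, of e] rate_le[OF g0] by (meson le_less_trans)

text \<open>Young's inequality for the inverse of \<open>\<phi>\<close> and its conjugate.  It trades the nonlinear function \<open>\<phi> s\<close> of the
misfit \<open>s\<close> for a linear term that can be absorbed and a remainder that depends on the parameter only.\<close>

lemma young:
  assumes "0 < t" "0 \<le> s" shows "\<phi> s \<le> s / t + rate t"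
proof -
  have "t * \<phi> s \<le> s + t * rate t"
    using conjugate_ge[of t s] conjugate_le_rate[of t] assms by simp
  then show ?thesis using assms by (simp add: field_simps)
qed

lemma Psi_inv_conjugate:
  assumes "0 < e" "e < conjugate t" "0 \<le> t"
  shows "0 < Psi_inv \<phi> e" "conjugate (Psi_inv \<phi> e) = e"
proof -
  have "continuous_on {0..t} conjugate" by (rule continuous_on_subset[OF conjugate_continuous]) auto
  then obtain s where s: "0 \<le> s" "s \<le> t" "conjugate s = e"
    using IVT'[of conjugate 0 e t] assms conjugate_zero by auto
  have "inj_on (Psi \<phi>) {0..}"
  proof (rule inj_onI)
    fix x y assume "x \<in> {0..}" "y \<in> {0..}" "Psi \<phi> x = Psi \<phi> y"
    then show "x = y"
      using conjugate_strict_mono[of x y] conjugate_strict_mono[of y x]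
      by (cases x y rule: linorder_cases) (auto simp: Psi_eq_conjugate)
  qed
  then have "Psi_inv \<phi> e = s"
    unfolding Psi_inv_def by (rule the_inv_into_f_eq) (use s in \<open>auto simp: Psi_eq_conjugate\<close>)
  then show "0 < Psi_inv \<phi> e" "conjugate (Psi_inv \<phi> e) = e"
    using s assms conjugate_zero by (auto simp: less_le)
qed

lemma conjugate_le_iff: "0 \<le> s \<Longrightarrow> 0 \<le> t \<Longrightarrow> conjugate s \<le> conjugate t \<longleftrightarrow> s \<le> t"
  using conjugate_strict_mono[of s t] conjugate_strict_mono[of t s]
  by (cases s t rule: linorder_cases) auto

end

section \<open>One Newton step\<close>

text \<open>The next two lemmas contain the arithmetic of a single step for the two types of the cone condition, with the
values of the functionals as extended real variables: \<open>s1\<close>, \<open>s2\<close> (\<open>t1\<close>, \<open>t2\<close>) are the data functionals at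
the linearization evaluated at the exact solution and at the new iterate, \<open>tu\<close> and \<open>tv\<close> the misfits of the old
and the new iterate, and \<open>eu\<close>, \<open>ev\<close>, \<open>ed\<close>, \<open>e1\<close>, \<open>e2\<close> the errors at the same points.  The upper cone
estimate serves to bound \<open>s1\<close> from above, the lower one to bound \<open>s2\<close> from below by the gain
\<open>tv / (C_tc C_err)\<close> up to error terms.\<close>

lemma cone_step_A:
  fixes s1 s2 sd su sv tv eu ev ed :: ereal and tu C_err C_tc \<eta> e :: real
  assumes C: "1 \<le> C_err" "1 \<le> C_tc" "0 \<le> \<eta>"
    and nonneg: "0 \<le> eu" "0 \<le> ev" "0 \<le> ed" "0 \<le> tu" "0 \<le> tv"
    and proper: "s1 \<noteq> -\<infinity>" "s2 \<noteq> -\<infinity>" "sd \<noteq> -\<infinity>" "su \<noteq> -\<infinity>" "sv \<noteq> -\<infinity>"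
    and upper: "s1 \<le> ereal C_tc * sd + ereal \<eta> * su"
    and lower: "ereal (1 / C_tc) * sv \<le> s2 + ereal \<eta> * su"
    and sd: "sd \<le> ereal C_err * ed"
    and su: "su \<le> ereal C_err * ereal tu + ereal C_err * eu"
    and tv: "tv \<le> ereal C_err * sv + ereal C_err * ev"
    and e: "ereal (1 / C_tc) * ev + ereal (2 * \<eta> * C_err) * eu + ereal (C_tc * C_err) * ed \<le> ereal e"
  shows "s1 + ereal (1 / (C_tc * C_err)) * tv \<le> s2 + ereal (2 * \<eta> * C_err * tu + e)" and "s1 < \<infinity>"
proof -
  \<comment> \<open>For \<open>\<eta> = 0\<close> the values \<open>su\<close> and \<open>eu\<close> may be infinite, but then both products vanish.\<close>
  have "\<exists>z w. ereal \<eta> * su = ereal z \<and> ereal (2 * \<eta> * C_err) * eu = ereal w \<and> 2 * z \<le> 2 * \<eta> * C_err * tu + w"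
  proof (cases "\<eta> = 0")
    case False
    then have \<eta>: "0 < \<eta>" using C by simp
    have "eu \<noteq> \<infinity>" using e C \<eta> nonneg by (cases ev; cases ed; auto)
    then obtain eu' where eu': "eu = ereal eu'" using nonneg by (cases eu) auto
    then obtain su' where su': "su = ereal su'" using su proper by (cases su) auto
    have "\<eta> * su' \<le> \<eta> * (C_err * tu + C_err * eu')"
      using su su' eu' \<eta> by (intro mult_left_mono) auto
    then show ?thesis by (auto simp: su' eu' algebra_simps)
  qed (auto simp: zero_ereal_def[symmetric])
  then obtain z w where z: "ereal \<eta> * su = ereal z"
    and w: "ereal (2 * \<eta> * C_err) * eu = ereal w" and zw: "2 * z \<le> 2 * \<eta> * C_err * tu + w"
    by blast
  have "ev \<noteq> \<infinity>" "ed \<noteq> \<infinity>" using e C nonneg unfolding w by (cases ev; cases ed; auto)+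
  then obtain ev' ed' where ev': "ev = ereal ev'" and ed': "ed = ereal ed'"
    using nonneg by (cases ev; cases ed; auto)
  then obtain sd' where sd': "sd = ereal sd'" using sd proper by (cases sd) auto
  then obtain s1' where s1': "s1 = ereal s1'" using upper proper z by (cases s1) auto
  show "s1 < \<infinity>" by (simp add: s1')
  have "C_tc * sd' \<le> C_tc * (C_err * ed')" using sd sd' ed' C by (intro mult_left_mono) auto
  then have s1_le: "s1' \<le> C_tc * C_err * ed' + z" using upper unfolding z s1' sd' by simp
  have e': "ev' / C_tc + w + C_tc * C_err * ed' \<le> e" using e unfolding w ev' ed' by simp
  show "s1 + ereal (1 / (C_tc * C_err)) * tv \<le> s2 + ereal (2 * \<eta> * C_err * tu + e)"
  proof (cases s2)
    case (real s2')
    then obtain sv' where sv': "sv = ereal sv'"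
      using lower proper z C by (cases sv) auto
    then obtain tv' where tv': "tv = ereal tv'" using tv nonneg ev' by (cases tv) auto
    have "tv' \<le> C_err * (sv' + ev')" using tv tv' ev' sv' by (simp add: algebra_simps)
    then have "tv' / (C_tc * C_err) \<le> C_err * (sv' + ev') / (C_tc * C_err)"
      using C by (intro divide_right_mono) auto
    also have "\<dots> = sv' / C_tc + ev' / C_tc" using C by (simp add: field_simps)
    finally have "tv' / (C_tc * C_err) \<le> sv' / C_tc + ev' / C_tc" .
    moreover have "sv' / C_tc \<le> s2' + z" using lower unfolding z real sv' by simp
    ultimately show ?thesis using s1_le zw e' by (simp add: s1' real tv')
  qed (use proper in auto)
qed

lemma cone_step_B:
  fixes s1 s2 t1 t2 tv e1 e2 :: ereal and tu C_err C_tc \<eta> e :: real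
  assumes C: "1 \<le> C_err" "1 \<le> C_tc" "0 \<le> \<eta>"
    and nonneg: "0 \<le> e1" "0 \<le> e2" "0 \<le> tu" "0 \<le> tv" "0 \<le> t1" "0 \<le> t2"
    and proper: "s1 \<noteq> -\<infinity>" "s2 \<noteq> -\<infinity>"
    and upper: "t1 \<le> ereal \<eta> * ereal tu"
    and lower: "ereal (1 / C_tc) * tv \<le> t2 + ereal \<eta> * ereal tu"
    and s1: "s1 \<le> ereal C_err * t1 + ereal C_err * e1"
    and t2: "t2 \<le> ereal C_err * s2 + ereal C_err * e2"
    and e: "e2 + ereal C_err * e1 \<le> ereal e"
  shows "s1 + ereal (1 / (C_tc * C_err)) * tv \<le> s2 + ereal (\<eta> * (C_err + 1 / C_err) * tu + e)"
    and "s1 < \<infinity>"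
proof -
  have "e1 \<noteq> \<infinity>" "e2 \<noteq> \<infinity>" using e C nonneg by (cases e1; cases e2; auto)+
  then obtain e1' e2' where e1': "e1 = ereal e1'" and e2': "e2 = ereal e2'"
    using nonneg by (cases e1; cases e2; auto)
  obtain t1' where t1': "t1 = ereal t1'" using upper nonneg by (cases t1) auto
  obtain s1' where s1': "s1 = ereal s1'" using s1 proper t1' e1' by (cases s1) auto
  show "s1 < \<infinity>" by (simp add: s1')
  have "C_err * t1' \<le> C_err * (\<eta> * tu)" using upper t1' C by (intro mult_left_mono) auto
  then have s1_le: "s1' \<le> C_err * \<eta> * tu + C_err * e1'" using s1 unfolding s1' t1' e1' by simp
  have e': "e2' + C_err * e1' \<le> e" using e unfolding e1' e2' by simp
  show "s1 + ereal (1 / (C_tc * C_err)) * tv \<le> s2 + ereal (\<eta> * (C_err + 1 / C_err) * tu + e)"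
  proof (cases s2)
    case (real s2')
    then obtain t2' where t2': "t2 = ereal t2'" using t2 nonneg e2' by (cases t2) auto
    then obtain tv' where tv': "tv = ereal tv'" using lower nonneg C by (cases tv) auto
    have "t2' \<le> C_err * (s2' + e2')" using t2 t2' e2' real by (simp add: algebra_simps)
    moreover have "tv' / C_tc \<le> t2' + \<eta> * tu" using lower unfolding tv' t2' by simp
    ultimately have "tv' / C_tc \<le> C_err * (s2' + e2') + \<eta> * tu" by linarith
    then have "tv' / C_tc / C_err \<le> (C_err * (s2' + e2') + \<eta> * tu) / C_err"
      using C by (intro divide_right_mono) auto
    also have "\<dots> = s2' + e2' + \<eta> * tu / C_err" using C by (simp add: field_simps)
    finally have "tv' / (C_tc * C_err) \<le> s2' + e2' + \<eta> * tu / C_err" by simp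
    then show ?thesis using s1_le e' by (simp add: s1' real tv' algebra_simps)
  qed (use proper in auto)
qed

text \<open>The constant \<open>C_NL\<close> is the maximum of the factors \<open>2 C_err\<close> and \<open>C_err + 1 / C_err\<close> that arise for the two types,
so one estimate covers both.\<close>

lemma cone_step:
  assumes C: "1 \<le> C_err" "1 \<le> C_tc" "0 \<le> \<eta>"
    and data: "data_functionals B F ud T Yobs S" "gobs \<in> Yobs"
    and cone: "tangential_cone ty \<eta> C_tc B F ud T Yobs S"
    and bound: "error_bound C_err T S (F ud) gobs err"
    and err: "err_term ty C_err C_tc \<eta> F ud err u n \<le> ereal e"
    and dom: "u n \<in> B" "u (Suc n) \<in> B"
    and tau: "T (F ud) (F (u n)) = ereal \<tau>"
  shows "S gobs (linearized F (u n) ud) + ereal (1 / (C_tc * C_err)) * T (F ud) (F (u (Suc n)))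
       \<le> S gobs (linearized F (u n) (u (Suc n))) + ereal (\<eta> * C_NL C_err * \<tau> + e)"
    and "S gobs (linearized F (u n) ud) < \<infinity>"
proof -
  let ?s1 = "S gobs (linearized F (u n) ud)" and ?s2 = "S gobs (linearized F (u n) (u (Suc n)))"
  let ?tv = "T (F ud) (F (u (Suc n)))"
  have ud: "ud \<in> B" and T_nonneg: "\<And>h. 0 \<le> T (F ud) h" and T_zero: "T (F ud) (F ud) = 0"
    and proper: "\<And>h. S gobs h \<noteq> -\<infinity>"
    using data by (auto simp: data_functionals_def)
  have tau0: "0 \<le> \<tau>" using T_nonneg[of "F (u n)"] tau by simp
  have err0: "0 \<le> err h" and S_le: "S gobs h \<le> ereal C_err * T (F ud) h + ereal C_err * err h"
    and T_le: "T (F ud) h \<le> ereal C_err * S gobs h + ereal C_err * err h" for h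
    using bound by (auto simp: error_bound_def)
  have NL: "\<eta> * (2 * C_err) * \<tau> \<le> \<eta> * C_NL C_err * \<tau>"
      "\<eta> * (C_err + 1 / C_err) * \<tau> \<le> \<eta> * C_NL C_err * \<tau>"
    using C tau0 by (auto simp: C_NL_def intro!: mult_right_mono mult_left_mono)
  have "?s1 + ereal (1 / (C_tc * C_err)) * ?tv \<le> ?s2 + ereal (\<eta> * C_NL C_err * \<tau> + e) \<and> ?s1 < \<infinity>"
  proof (cases ty)
    case TypeA
    have cone': "cone_estimate \<eta> C_tc B F (S gobs)" using cone data TypeA by simp
    note est = cone'[unfolded cone_estimate_def, rule_format]
    note step = cone_step_A[OF C, of "err (F (u n))" "err (F (u (Suc n)))" "err (F ud)" \<tau> ?tv ?s1 ?s2
        "S gobs (F ud)" "S gobs (F (u n))" "S gobs (F (u (Suc n)))" e,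
        OF err0 err0 err0 tau0 T_nonneg proper proper proper proper proper
          conjunct2[OF est[OF dom(1) ud]] conjunct1[OF est[OF dom]]]
    have "?s1 + ereal (1 / (C_tc * C_err)) * ?tv \<le> ?s2 + ereal (2 * \<eta> * C_err * \<tau> + e) \<and> ?s1 < \<infinity>"
      using step S_le[of "F ud"] S_le[of "F (u n)"] T_le[of "F (u (Suc n))"] err
      by (simp add: T_zero tau TypeA)
    moreover have "?s2 + ereal (2 * \<eta> * C_err * \<tau> + e) \<le> ?s2 + ereal (\<eta> * C_NL C_err * \<tau> + e)"
      using NL(1) by (intro add_left_mono) (simp add: ac_simps)
    ultimately show ?thesis by (meson order.trans)
  next
    case TypeB
    have cone': "cone_estimate \<eta> C_tc B F (T (F ud))" using cone TypeB by simp
    note est = cone'[unfolded cone_estimate_def, rule_format]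
    note step = cone_step_B[OF C, of "err (linearized F (u n) ud)" "err (linearized F (u n) (u (Suc n)))"
        \<tau> ?tv "T (F ud) (linearized F (u n) ud)" "T (F ud) (linearized F (u n) (u (Suc n)))" ?s1 ?s2 e,
        OF err0 err0 tau0 T_nonneg T_nonneg T_nonneg proper proper]
    have "?s1 + ereal (1 / (C_tc * C_err)) * ?tv
        \<le> ?s2 + ereal (\<eta> * (C_err + 1 / C_err) * \<tau> + e) \<and> ?s1 < \<infinity>"
      using step conjunct2[OF est[OF dom(1) ud]] conjunct1[OF est[OF dom]]
        S_le[of "linearized F (u n) ud"] T_le[of "linearized F (u n) (u (Suc n))"] err
      by (simp add: T_zero tau TypeB)
    moreover have "?s2 + ereal (\<eta> * (C_err + 1 / C_err) * \<tau> + e) \<le> ?s2 + ereal (\<eta> * C_NL C_err * \<tau> + e)"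
      using NL(2) by (intro add_left_mono) simp
    ultimately show ?thesis by (meson order.trans)
  qed
  then show "?s1 + ereal (1 / (C_tc * C_err)) * ?tv \<le> ?s2 + ereal (\<eta> * C_NL C_err * \<tau> + e)" "?s1 < \<infinity>"
    by auto
qed

text \<open>Here \<open>s1\<close> and \<open>s2\<close> are the data terms at the exact solution and at the minimizer \<open>v\<close>.  Minimality bounds
\<open>R v - R ud\<close> by \<open>(s1 - s2) / \<alpha>\<close>, \<open>gain\<close> converts this into a bound that decreases with the misfit of \<open>v\<close>, and the source condition
replaces the linear part of the Bregman distance.  Finiteness of all quantities at \<open>v\<close> comes out on the way.\<close>

lemma minimizer_step:
  fixes R :: "'x::real_normed_vector \<Rightarrow> ereal" and us :: "'x \<Rightarrow>\<^sub>L real"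
    and s1 s2 :: ereal and \<alpha> K \<kappa> :: real
  assumes R: "\<And>v. R v \<noteq> -\<infinity>" and us: "us \<in> subdifferential R ud"
    and vsc: "T (F ud) (F v) < \<infinity> \<Longrightarrow> ereal (blinfun_apply us (ud - v))
          \<le> ereal \<beta>\<^sub>1 * bregman R us v ud + ereal (\<beta>\<^sub>2 * \<phi> (real_of_ereal (T (F ud) (F v))))"
    and nonneg: "0 \<le> T (F ud) (F v)" and pos: "0 < \<alpha>" "0 < \<kappa>"
    and proper: "s1 \<noteq> -\<infinity>" "s2 \<noteq> -\<infinity>" "s1 < \<infinity>"
    and min: "s2 + ereal \<alpha> * R v \<le> s1 + ereal \<alpha> * R ud"
    and gain: "s1 + ereal \<kappa> * T (F ud) (F v) \<le> s2 + ereal K"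
  shows "\<exists>\<tau> D. T (F ud) (F v) = ereal \<tau> \<and> 0 \<le> \<tau> \<and> bregman R us v ud = ereal D \<and> 0 \<le> D \<and>
      (1 - \<beta>\<^sub>1) * D + \<kappa> * \<tau> / \<alpha> \<le> K / \<alpha> + \<beta>\<^sub>2 * \<phi> \<tau>"
proof -
  have Rud_fin: "\<bar>R ud\<bar> \<noteq> \<infinity>" and sub: "R ud + ereal (blinfun_apply us (v - ud)) \<le> R v"
    using us by (auto simp: subdifferential_def)
  obtain rd where rd: "R ud = ereal rd" using Rud_fin by (cases "R ud") auto
  obtain a where a: "s1 = ereal a" using proper by (cases s1) auto
  obtain b where b: "s2 = ereal b" using min proper R[of v] pos
    by (cases s2; cases "R v") (auto simp: a rd)
  obtain rv where rv: "R v = ereal rv" using min R[of v] pos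
    by (cases "R v") (auto simp: a b rd)
  obtain \<tau> where tau: "T (F ud) (F v) = ereal \<tau>" using gain nonneg pos
    by (cases "T (F ud) (F v)") (auto simp: a b)
  define D where "D = rv - rd - blinfun_apply us (v - ud)"
  have D: "bregman R us v ud = ereal D" by (simp add: bregman_def D_def rd rv)
  have "\<alpha> * (rv - rd) \<le> K - \<kappa> * \<tau>"
    using min gain by (simp add: a b rd rv tau algebra_simps)
  then have "rv - rd \<le> (K - \<kappa> * \<tau>) / \<alpha>" using pos by (simp add: field_simps)
  moreover have "- blinfun_apply us (v - ud) \<le> \<beta>\<^sub>1 * D + \<beta>\<^sub>2 * \<phi> \<tau>"
    using vsc by (simp add: tau D blinfun.diff_right)
  ultimately have "D - \<beta>\<^sub>1 * D + \<kappa> * \<tau> / \<alpha> \<le> K / \<alpha> + \<beta>\<^sub>2 * \<phi> \<tau>"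
    using D_def unfolding diff_divide_distrib by linarith
  then have "(1 - \<beta>\<^sub>1) * D + \<kappa> * \<tau> / \<alpha> \<le> K / \<alpha> + \<beta>\<^sub>2 * \<phi> \<tau>"
    by (simp add: left_diff_distrib)
  moreover have "0 \<le> D" using sub by (simp add: rd rv D_def)
  ultimately show ?thesis using tau D nonneg by auto
qed

text \<open>Everything that the constants of the final estimates may depend on is fixed in this locale; the data, the error
functional, the noise level and the iterates are added in \<open>newton_run\<close>.\<close>

locale newton_problem = finite_rate \<phi> g0
  for \<phi> g0 :: "real \<Rightarrow> real" +
  fixes B :: "'x::banach set" and F :: "'x \<Rightarrow> 'y::banach" and R :: "'x \<Rightarrow> ereal" and ud :: 'x
    and T :: "'y \<Rightarrow> 'y \<Rightarrow> ereal" and Yobs :: "'o set" and S :: "'o \<Rightarrow> 'y \<Rightarrow> ereal"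
    and us :: "'x \<Rightarrow>\<^sub>L real" and u\<^sub>0 :: 'x and \<alpha> :: "nat \<Rightarrow> real" and ty :: cone_type
    and \<eta> \<beta>\<^sub>1 \<beta>\<^sub>2 C_err C_tc C_dec :: real
  assumes C_err: "1 \<le> C_err" and C_tc: "1 \<le> C_tc" and eta: "0 \<le> \<eta>"
    and beta1: "\<beta>\<^sub>1 < 1 / 2" and beta2: "0 < \<beta>\<^sub>2"
    and beta2_small: "\<beta>\<^sub>2 < 1 / (C_tc * C_err)"
    and eta_small: "C_dec\<^sup>2 * gamma_bar C_err C_tc C_dec \<eta> \<beta>\<^sub>2 < 1"
    and params: "regularization_parameters C_dec \<alpha>"
    and penalty: "proper_convex R"
    and data: "data_functionals B F ud T Yobs S"
    and cone: "tangential_cone ty \<eta> C_tc B F ud T Yobs S"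
    and vsc: "additive_vsc B F R T ud us \<beta>\<^sub>1 \<beta>\<^sub>2 \<phi>"
    and initial: "u\<^sub>0 \<in> B" "T (F ud) (F u\<^sub>0) < \<infinity>"
begin

lemma alpha_pos: "0 < \<alpha> n"
  and alpha_tendsto: "\<alpha> \<longlonglongrightarrow> 0"
  using params by (auto simp: regularization_parameters_def)

lemma alpha_Suc_le: "\<alpha> (Suc n) \<le> \<alpha> n"
  and alpha_le_Suc: "\<alpha> n \<le> C_dec * \<alpha> (Suc n)"
  using params alpha_pos[of "Suc n"] by (auto simp: regularization_parameters_def divide_le_eq le_divide_eq)

lemma alpha_antimono: "m \<le> n \<Longrightarrow> \<alpha> n \<le> \<alpha> m"
  using decseq_SucI[of \<alpha>] alpha_Suc_le by (auto simp: decseq_def)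

lemma C_dec: "1 \<le> C_dec"
  using params unfolding regularization_parameters_def by (meson order.trans)

lemma rate_alpha_le_Suc: "rate (\<alpha> n) \<le> C_dec\<^sup>2 * rate (\<alpha> (Suc n))"
  using rate_le_quadratic[OF C_dec] alpha_le_Suc alpha_pos by (simp add: less_imp_le)

text \<open>Relative to the other two error components, the nonlinearity error is multiplied by this factor in every step, up
to an additive term.\<close>

definition contraction :: real where
  "contraction = C_dec\<^sup>2 * gamma_bar C_err C_tc C_dec \<eta> \<beta>\<^sub>2"

lemma C_NL_pos: "0 < C_NL C_err"
  using C_err by (simp add: C_NL_def)

lemma gamma_bar_nonneg: "0 \<le> gamma_bar C_err C_tc C_dec \<eta> \<beta>\<^sub>2"
  using eta C_dec C_NL_pos beta2_small by (simp add: gamma_bar_def)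

lemma contraction: "0 \<le> contraction" "contraction < 1"
  using eta_small gamma_bar_nonneg by (auto simp: contraction_def)

text \<open>The value of \<open>gamma_nl\<close> for noise level \<open>0\<close>.  It is a bound for all noise levels, as \<open>gamma_nl\<close> decreases
in the noise level.\<close>

definition gamma_max :: real where
  "gamma_max = max (contraction / (1 - contraction))
     (2 * \<eta> * C_NL C_err * real_of_ereal (T (F ud) (F u\<^sub>0)) / \<alpha> 0 / (2 * \<beta>\<^sub>2 * rate (\<alpha> 0)))"

lemma gamma_max_nonneg: "0 \<le> gamma_max"
  using contraction by (simp add: gamma_max_def le_max_iff_disj)

end

text \<open>The noise level \<open>e = 0\<close> is admitted so that exact data are a special case.\<close>

locale newton_run = newton_problem +
  fixes gobs err e u
  assumes gobs: "gobs \<in> Yobs"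
    and bound: "error_bound C_err T S (F ud) gobs err"
    and iterates: "newton_iterates B F R S \<alpha> gobs u\<^sub>0 u"
    and err_le: "\<And>n. err_term ty C_err C_tc \<eta> F ud err u n \<le> ereal e"
    and e_nonneg: "0 \<le> e"
begin

definition tau :: "nat \<Rightarrow> real" where
  "tau n = real_of_ereal (T (F ud) (F (u n)))"

definition D :: "nat \<Rightarrow> real" where
  "D n = real_of_ereal (bregman R us (u n) ud)"

lemma iterate_dom: "u n \<in> B"
  using iterates initial by (cases n) (auto simp: newton_iterates_def is_arg_min_def)

lemma finite_step:
  assumes tau: "T (F ud) (F (u n)) = ereal \<tau>"
  shows "\<exists>\<tau>' d. T (F ud) (F (u (Suc n))) = ereal \<tau>' \<and> 0 \<le> \<tau>' \<and>
      bregman R us (u (Suc n)) ud = ereal d \<and> 0 \<le> d \<and>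
      (1 - \<beta>\<^sub>1) * d + 1 / (C_tc * C_err) * \<tau>' / \<alpha> n \<le> (\<eta> * C_NL C_err * \<tau> + e) / \<alpha> n + \<beta>\<^sub>2 * \<phi> \<tau>'"
proof (rule minimizer_step)
  note step = cone_step[OF C_err C_tc eta data gobs cone bound err_le iterate_dom iterate_dom tau]
  show "S gobs (linearized F (u n) ud) + ereal (1 / (C_tc * C_err)) * T (F ud) (F (u (Suc n)))
       \<le> S gobs (linearized F (u n) (u (Suc n))) + ereal (\<eta> * C_NL C_err * \<tau> + e)"
    by (rule step(1))
  show "S gobs (linearized F (u n) ud) < \<infinity>" by (rule step(2))
  have "ud \<in> B" using data by (simp add: data_functionals_def)
  then show "S gobs (linearized F (u n) (u (Suc n))) + ereal (\<alpha> n) * R (u (Suc n))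
      \<le> S gobs (linearized F (u n) ud) + ereal (\<alpha> n) * R ud"
    using iterates by (auto simp: newton_iterates_def is_arg_min_def not_less)
qed (use penalty vsc iterate_dom data gobs alpha_pos C_err C_tc in
      \<open>auto simp: proper_convex_def additive_vsc_def data_functionals_def\<close>)

lemma T_eq_tau: "T (F ud) (F (u n)) = ereal (tau n)"
  and tau_nonneg: "0 \<le> tau n"
proof -
  have "\<exists>\<tau>. T (F ud) (F (u n)) = ereal \<tau> \<and> 0 \<le> \<tau>" for n
  proof (induction n)
    case 0
    have "0 \<le> T (F ud) (F u\<^sub>0)" "u 0 = u\<^sub>0"
      using data iterates by (auto simp: data_functionals_def newton_iterates_def)
    then show ?case using initial by (cases "T (F ud) (F u\<^sub>0)") auto
  next
    case (Suc n)
    then show ?case using finite_step by blast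
  qed
  from this[of n] show "T (F ud) (F (u n)) = ereal (tau n)" "0 \<le> tau n"
    by (auto simp: tau_def)
qed

lemma bregman_eq_D: "bregman R us (u (Suc n)) ud = ereal (D (Suc n))"
  and D_nonneg: "0 \<le> D (Suc n)"
  and newton_step: "(1 - \<beta>\<^sub>1) * D (Suc n) + 1 / (C_tc * C_err) * tau (Suc n) / \<alpha> n
      \<le> (\<eta> * C_NL C_err * tau n + e) / \<alpha> n + \<beta>\<^sub>2 * \<phi> (tau (Suc n))"
  using finite_step[OF T_eq_tau[of n]] by (auto simp: D_def T_eq_tau)

text \<open>The error components \<open>Phi_nl\<close> and \<open>Phi_app + Phi_noi\<close> as real numbers, with the index shifted by one:
\<open>nl_error n\<close> is \<open>Phi_nl (n + 1)\<close>.\<close>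

definition nl_error :: "nat \<Rightarrow> real" where
  "nl_error n = 2 * \<eta> * C_NL C_err * tau n / \<alpha> n"

definition app_noi_error :: "nat \<Rightarrow> real" where
  "app_noi_error n = 2 * \<beta>\<^sub>2 * rate (\<alpha> n) + 2 * e / \<alpha> n"

lemma app_noi_error_pos: "0 < app_noi_error n"
  using beta2 rate_pos[OF alpha_pos] alpha_pos[of n] e_nonneg
  by (auto simp: app_noi_error_def intro!: add_pos_nonneg)

lemma nl_error_nonneg: "0 \<le> nl_error n"
  using eta C_NL_pos tau_nonneg alpha_pos by (simp add: nl_error_def less_imp_le)

text \<open>Young's inequality with parameter \<open>\<alpha>\<^sub>n\<close> splits the source term; its linear part takes \<open>\<beta>\<^sub>2\<close> away from the
coefficient of the gain.  The factor \<open>2\<close> throughout comes from \<open>1 - \<beta>\<^sub>1 \<ge> 1 / 2\<close>.\<close>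

lemma error_decomposition:
  "D (Suc n) + 2 * (1 / (C_tc * C_err) - \<beta>\<^sub>2) * tau (Suc n) / \<alpha> n \<le> nl_error n + app_noi_error n"
proof -
  define x y z where "x = 1 / (C_tc * C_err) * tau (Suc n) / \<alpha> n"
    and "y = \<beta>\<^sub>2 * (tau (Suc n) / \<alpha> n)" and "z = (\<eta> * C_NL C_err * tau n + e) / \<alpha> n"
  have "\<beta>\<^sub>2 * \<phi> (tau (Suc n)) \<le> \<beta>\<^sub>2 * (tau (Suc n) / \<alpha> n + rate (\<alpha> n))"
    using young[OF alpha_pos tau_nonneg] beta2 by (intro mult_left_mono) auto
  then have "\<beta>\<^sub>2 * \<phi> (tau (Suc n)) \<le> y + \<beta>\<^sub>2 * rate (\<alpha> n)"
    by (simp only: y_def distrib_left)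
  moreover have "1 / 2 * D (Suc n) \<le> (1 - \<beta>\<^sub>1) * D (Suc n)"
    using beta1 D_nonneg by (intro mult_right_mono) auto
  moreover have "(1 - \<beta>\<^sub>1) * D (Suc n) + x \<le> z + \<beta>\<^sub>2 * \<phi> (tau (Suc n))"
    using newton_step[of n] by (simp only: x_def z_def)
  moreover have "b + 2 * (x - y) \<le> 2 * (z + r)"
    if "a \<le> y + r" "1 / 2 * b \<le> d" "d + x \<le> z + a" for a b d r :: real
    using that by argo
  ultimately have "D (Suc n) + 2 * (x - y) \<le> 2 * (z + \<beta>\<^sub>2 * rate (\<alpha> n))"
    by blast
  moreover have "nl_error n + app_noi_error n = 2 * (z + \<beta>\<^sub>2 * rate (\<alpha> n))"
    by (simp add: nl_error_def app_noi_error_def z_def algebra_simps add_divide_distrib)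
  moreover have "2 * (1 / (C_tc * C_err) - \<beta>\<^sub>2) * tau (Suc n) / \<alpha> n = 2 * (x - y)"
    by (simp add: x_def y_def algebra_simps diff_divide_distrib)
  ultimately show ?thesis by (simp only:)
qed

text \<open>The gain in \<open>error_decomposition\<close>, discarded when the Bregman distance is estimated, here controls the next misfit.\<close>

lemma nl_error_Suc_le: "nl_error (Suc n) \<le> gamma_bar C_err C_tc C_dec \<eta> \<beta>\<^sub>2 * (nl_error n + app_noi_error n)"
proof -
  define \<kappa> where "\<kappa> = 1 / (C_tc * C_err) - \<beta>\<^sub>2"
  have k: "0 < \<kappa>" using beta2_small by (simp add: \<kappa>_def)
  have "1 / \<alpha> (Suc n) \<le> C_dec / \<alpha> n"
    using alpha_le_Suc[of n] alpha_pos[of n] alpha_pos[of "Suc n"] by (simp add: field_simps)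
  then have "2 * \<eta> * C_NL C_err * tau (Suc n) * (1 / \<alpha> (Suc n))
      \<le> 2 * \<eta> * C_NL C_err * tau (Suc n) * (C_dec / \<alpha> n)"
    using eta C_NL_pos tau_nonneg by (intro mult_left_mono) (auto simp: less_imp_le)
  also have "\<dots> = \<eta> * C_dec * C_NL C_err / \<kappa> * (2 * \<kappa> * tau (Suc n) / \<alpha> n)"
    using k by simp
  also have "\<dots> = gamma_bar C_err C_tc C_dec \<eta> \<beta>\<^sub>2 * (2 * \<kappa> * tau (Suc n) / \<alpha> n)"
    by (simp add: gamma_bar_def \<kappa>_def)
  also have "\<dots> \<le> gamma_bar C_err C_tc C_dec \<eta> \<beta>\<^sub>2 * (nl_error n + app_noi_error n)"
    using error_decomposition[of n] D_nonneg[of n]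
    by (intro mult_left_mono gamma_bar_nonneg) (simp add: \<kappa>_def)
  finally show ?thesis by (simp add: nl_error_def)
qed

lemma app_noi_error_le_Suc: "app_noi_error n \<le> C_dec\<^sup>2 * app_noi_error (Suc n)"
proof -
  have "2 * \<beta>\<^sub>2 * rate (\<alpha> n) \<le> 2 * \<beta>\<^sub>2 * (C_dec\<^sup>2 * rate (\<alpha> (Suc n)))"
    using beta2 rate_alpha_le_Suc by (intro mult_left_mono) auto
  moreover have "1 * (2 * e / \<alpha> n) \<le> C_dec\<^sup>2 * (2 * e / \<alpha> (Suc n))"
    using C_dec alpha_pos alpha_Suc_le e_nonneg
    by (intro mult_mono divide_left_mono) (auto simp: less_imp_le)
  ultimately show ?thesis unfolding app_noi_error_def distrib_left by (simp only: mult_1 mult.left_commute add_mono)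
qed

definition gamma :: real where
  "gamma = max (contraction / (1 - contraction)) (nl_error 0 / app_noi_error 0)"

lemma gamma_nonneg: "0 \<le> gamma"
  using contraction by (simp add: gamma_def le_max_iff_disj)

lemma gamma_le_max: "gamma \<le> gamma_max"
proof -
  have "u 0 = u\<^sub>0" using iterates by (simp add: newton_iterates_def)
  moreover have "nl_error 0 / app_noi_error 0 \<le> nl_error 0 / (2 * \<beta>\<^sub>2 * rate (\<alpha> 0))"
    using beta2 rate_pos[OF alpha_pos[of 0]] app_noi_error_pos[of 0] nl_error_nonneg e_nonneg alpha_pos[of 0]
    by (intro divide_left_mono mult_pos_pos) (auto simp: app_noi_error_def)
  ultimately show ?thesis
    unfolding gamma_def gamma_max_def by (intro max.mono) (auto simp: nl_error_def tau_def)
qed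

text \<open>Passing from \<open>n\<close> to \<open>n + 1\<close>, the bound is preserved if \<open>contraction * (1 + gamma) \<le> gamma\<close>, which is the first
alternative in the maximum defining \<open>gamma\<close>; the second one starts the induction.\<close>

lemma nl_error_le: "nl_error n \<le> gamma * app_noi_error n"
proof (induction n)
  case 0
  have "nl_error 0 / app_noi_error 0 \<le> gamma" by (simp add: gamma_def)
  then show ?case using app_noi_error_pos[of 0] by (simp add: field_simps)
next
  case (Suc n)
  have "nl_error (Suc n) \<le> gamma_bar C_err C_tc C_dec \<eta> \<beta>\<^sub>2 * (nl_error n + app_noi_error n)" by (rule nl_error_Suc_le)
  also have "\<dots> \<le> gamma_bar C_err C_tc C_dec \<eta> \<beta>\<^sub>2 * ((1 + gamma) * app_noi_error n)"
    using Suc by (intro mult_left_mono gamma_bar_nonneg) (simp add: algebra_simps)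
  also have "\<dots> \<le> gamma_bar C_err C_tc C_dec \<eta> \<beta>\<^sub>2 * ((1 + gamma) * (C_dec\<^sup>2 * app_noi_error (Suc n)))"
    using gamma_nonneg by (intro mult_left_mono gamma_bar_nonneg app_noi_error_le_Suc) auto
  also have "\<dots> = contraction * (1 + gamma) * app_noi_error (Suc n)"
    by (simp add: contraction_def)
  also have "\<dots> \<le> gamma * app_noi_error (Suc n)"
  proof (intro mult_right_mono)
    have "contraction / (1 - contraction) \<le> gamma" by (simp add: gamma_def)
    then have "contraction \<le> gamma * (1 - contraction)"
      using contraction by (subst (asm) pos_divide_le_eq) auto
    then show "contraction * (1 + gamma) \<le> gamma" by (simp add: algebra_simps)
  qed (use app_noi_error_pos[of "Suc n"] in simp)
  finally show ?case .
qed

lemma D_le: "D (Suc n) \<le> (1 + gamma) * app_noi_error n"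
proof -
  have "0 \<le> 2 * (1 / (C_tc * C_err) - \<beta>\<^sub>2) * tau (Suc n) / \<alpha> n"
    using beta2_small tau_nonneg alpha_pos
    by (intro divide_nonneg_nonneg mult_nonneg_nonneg) (auto simp: less_imp_le)
  then show ?thesis
    using error_decomposition[of n] nl_error_le[of n] by (simp add: algebra_simps)
qed

lemma gamma_nl_eq: "gamma_nl C_err C_tc C_dec \<eta> \<beta>\<^sub>2 \<phi> \<alpha> (\<lambda>v. T (F ud) (F v)) e u = ereal gamma"
proof -
  have "Phi_nl \<eta> C_err (\<lambda>v. T (F ud) (F v)) \<alpha> u 1 = ereal (nl_error 0)"
    using alpha_pos[of 0] by (simp add: Phi_nl_def nl_error_def T_eq_tau)
  moreover have "Phi_app \<beta>\<^sub>2 \<phi> \<alpha> 1 + ereal (Phi_noi e \<alpha> 1) = ereal (app_noi_error 0)"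
    using alpha_pos[of 0] by (simp add: Phi_app_def Phi_noi_def app_noi_error_def Lam_eq_rate)
  moreover have "ereal (nl_error 0) / ereal (app_noi_error 0) = ereal (nl_error 0 / app_noi_error 0)"
    using app_noi_error_pos[of 0] by simp
  ultimately show ?thesis
    by (simp add: gamma_nl_def Let_def gamma_def contraction_def)
qed

lemma exact_data_rate:
  assumes "e = 0"
  shows "D (Suc n) \<le> (1 + gamma_max) * (2 * \<beta>\<^sub>2 * C_dec\<^sup>2) * rate (\<alpha> (Suc n))"
proof -
  have "D (Suc n) \<le> (1 + gamma) * app_noi_error n" by (rule D_le)
  also have "\<dots> \<le> (1 + gamma_max) * app_noi_error n"
    using gamma_le_max app_noi_error_pos[of n] by (intro mult_right_mono) auto
  also have "app_noi_error n = 2 * \<beta>\<^sub>2 * rate (\<alpha> n)"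
    using assms unfolding app_noi_error_def by simp
  also have "(1 + gamma_max) * (2 * \<beta>\<^sub>2 * rate (\<alpha> n))
      \<le> (1 + gamma_max) * (2 * \<beta>\<^sub>2 * (C_dec\<^sup>2 * rate (\<alpha> (Suc n))))"
    using gamma_max_nonneg beta2 by (intro mult_left_mono rate_alpha_le_Suc) auto
  finally show ?thesis by (simp add: ac_simps)
qed

end

locale noisy_run = newton_run +
  assumes e_pos: "0 < e" and e_small: "e < conjugate (\<alpha> 0)"
begin

text \<open>The parameter \<open>\<alpha>\<close> with \<open>e / \<alpha> = Psi(\<alpha>) / \<alpha>\<close>, the quotient of which \<open>\<Lambda>\<close> is a majorant.\<close>

abbreviation alpha_opt where "alpha_opt \<equiv> Psi_inv \<phi> e"

lemma alpha_opt_pos: "0 < alpha_opt" and conjugate_alpha_opt: "conjugate alpha_opt = e"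
  using Psi_inv_conjugate[OF e_pos e_small] alpha_pos[of 0] by (auto simp: less_imp_le)

lemma alpha_opt_less: "alpha_opt < \<alpha> 0"
  using conjugate_le_iff[of "\<alpha> 0" alpha_opt] conjugate_alpha_opt e_small alpha_opt_pos alpha_pos[of 0] by force

text \<open>The rule stops at the first \<open>\<alpha>\<^sub>n\<close> not exceeding \<open>alpha_opt\<close>.  The error at that index is governed by the
preceding parameter, which exceeds \<open>alpha_opt\<close>, so that the noise error is dominated there by \<open>\<Lambda>\<close>,
but is at most \<open>C_dec alpha_opt\<close>.\<close>

lemma a_priori_rate:
  "bregman R us (u (n_star \<phi> \<alpha> e)) ud \<le> ereal ((1 + gamma_max) * (2 * \<beta>\<^sub>2 + 2) * C_dec\<^sup>2 * rate alpha_opt)"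
proof -
  have stop: "Psi \<phi> (\<alpha> n) \<le> ereal e \<longleftrightarrow> \<alpha> n \<le> alpha_opt" for n
    using conjugate_le_iff[of "\<alpha> n" alpha_opt] conjugate_alpha_opt alpha_opt_pos alpha_pos[of n]
    by (simp add: Psi_eq_conjugate)
  define N where "N = (LEAST n. \<alpha> n \<le> alpha_opt)"
  have N_eq: "n_star \<phi> \<alpha> e = N" by (simp add: n_star_def stop N_def)
  have "\<exists>n. \<alpha> n \<le> alpha_opt"
    using order_tendstoD(2)[OF alpha_tendsto alpha_opt_pos]
    by (metis eventually_sequentially less_imp_le order_refl)
  then have N: "\<alpha> N \<le> alpha_opt" unfolding N_def by (rule LeastI_ex)
  then obtain k where k: "N = Suc k" using alpha_opt_less by (cases N) auto
  have ak: "alpha_opt < \<alpha> k" using not_less_Least[of k "\<lambda>n. \<alpha> n \<le> alpha_opt"] k by (auto simp: N_def)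
  have "e \<le> \<alpha> k * rate (\<alpha> k)"
    using conjugate_le_rate[OF alpha_pos, of k] conjugate_strict_mono[of alpha_opt "\<alpha> k"] ak alpha_opt_pos conjugate_alpha_opt
    by simp
  then have "2 * e / \<alpha> k \<le> 2 * rate (\<alpha> k)" using alpha_pos[of k] by (simp add: field_simps)
  then have "app_noi_error k \<le> (2 * \<beta>\<^sub>2 + 2) * rate (\<alpha> k)" by (simp add: app_noi_error_def algebra_simps)
  also have "\<dots> \<le> (2 * \<beta>\<^sub>2 + 2) * (C_dec\<^sup>2 * rate alpha_opt)"
  proof (intro mult_left_mono rate_le_quadratic[OF C_dec])
    have "C_dec * \<alpha> (Suc k) \<le> C_dec * alpha_opt" using N k C_dec by (intro mult_left_mono) auto
    then show "\<alpha> k \<le> C_dec * alpha_opt" using alpha_le_Suc[of k] by simp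
  qed (use alpha_opt_pos alpha_pos[of k] beta2 in auto)
  finally have "(1 + gamma) * app_noi_error k \<le> (1 + gamma_max) * ((2 * \<beta>\<^sub>2 + 2) * (C_dec\<^sup>2 * rate alpha_opt))"
    using gamma_le_max gamma_nonneg app_noi_error_pos[of k] by (intro mult_mono) auto
  then show ?thesis
    using D_le[of k] bregman_eq_D[of k] by (simp add: N_eq k ac_simps)
qed

end

text \<open>The assumption \<open>rate_below\<close> holds for all small noise levels, since the rate vanishes at \<open>0\<close>.  It guarantees that
the noise error dominates the approximation error at the index \<open>N_max\<close> at the latest.\<close>

locale coercive_run = noisy_run +
  fixes q C_bd :: real
  assumes q: "1 < q" and C_bd: "0 < C_bd"
    and coercive: "\<And>v. ereal (norm (v - ud) powr q) \<le> ereal C_bd * bregman R us v ud"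
    and rate_below: "\<And>t. 0 \<le> t \<Longrightarrow> t \<le> 2 * e * C_bd \<Longrightarrow> 2 * \<beta>\<^sub>2 * rate t \<le> 1 / C_bd"
begin

abbreviation noi_error where "noi_error \<equiv> Phi_noi e \<alpha>"

lemma noi_error_pos: "0 < noi_error n"
  using e_pos alpha_pos by (simp add: Phi_noi_def)

lemma noi_error_mono: "m \<le> n \<Longrightarrow> noi_error m \<le> noi_error n"
  using e_pos alpha_pos alpha_antimono[of "m - 1" "n - 1"]
  by (auto simp: Phi_noi_def intro!: divide_left_mono)

definition dominated :: "nat \<Rightarrow> bool" where
  "dominated n \<longleftrightarrow> 1 \<le> n \<and> 2 * \<beta>\<^sub>2 * rate (\<alpha> (n - 1)) \<le> noi_error n"

lemma dominated_mono:
  assumes "dominated m" "m \<le> n" shows "dominated n"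
proof -
  have "rate (\<alpha> (n - 1)) \<le> rate (\<alpha> (m - 1))"
    using assms alpha_pos by (intro rate_mono alpha_antimono) (auto simp: less_imp_le)
  then have "2 * \<beta>\<^sub>2 * rate (\<alpha> (n - 1)) \<le> 2 * \<beta>\<^sub>2 * rate (\<alpha> (m - 1))"
    using beta2 by (intro mult_left_mono) auto
  then show ?thesis using assms noi_error_mono[of m n] by (auto simp: dominated_def)
qed

text \<open>Once the noise error dominates, the total error is at most \<open>2 (1 + gamma)\<close> times the noise error.  This factor
leaves the \<open>q\<close>-th root by \<open>g powr (1 / q) \<le> g\<close> for \<open>g \<ge> 1\<close>; this is the origin of the factor \<open>4\<close> in the
threshold of the balancing rule, where two such errors are added.\<close>

lemma norm_le_of_dominated:
  assumes "dominated n"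
  shows "norm (u n - ud) \<le> 2 * C_bd powr (1 / q) * (1 + gamma) * noi_error n powr (1 / q)"
proof -
  obtain k where k: "n = Suc k" using assms by (cases n) (auto simp: dominated_def)
  define g where "g = 2 * (1 + gamma)"
  have g: "1 \<le> g" using gamma_nonneg by (simp add: g_def)
  have "norm (u n - ud) powr q \<le> C_bd * D n"
    using coercive[of "u n"] bregman_eq_D[of k] k by simp
  also have "\<dots> \<le> C_bd * ((1 + gamma) * app_noi_error k)"
    using D_le[of k] C_bd k by (intro mult_left_mono) auto
  also have "\<dots> \<le> C_bd * ((1 + gamma) * (2 * noi_error n))"
    using assms C_bd gamma_nonneg k
    by (intro mult_left_mono) (auto simp: dominated_def app_noi_error_def Phi_noi_def)
  also have "\<dots> = C_bd * g * noi_error n" by (simp add: g_def)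
  finally have "(norm (u n - ud) powr q) powr (1 / q) \<le> (C_bd * g * noi_error n) powr (1 / q)"
    using q by (intro powr_mono2) auto
  then have "norm (u n - ud) \<le> C_bd powr (1 / q) * g powr (1 / q) * noi_error n powr (1 / q)"
    using q C_bd g noi_error_pos[of n] by (simp add: powr_powr powr_mult)
  also have "\<dots> \<le> C_bd powr (1 / q) * g * noi_error n powr (1 / q)"
    using powr_mono[of "1 / q" 1 g] q g by (intro mult_left_mono mult_right_mono) auto
  finally show ?thesis by (simp add: g_def algebra_simps)
qed

lemma dominated_N_max: "dominated (N_max C_bd q \<alpha> e)"
proof -
  let ?N = "N_max C_bd q \<alpha> e"
  let ?P = "\<lambda>n. 1 \<le> n \<and> 1 \<le> C_bd powr (1 / q) * noi_error n powr (1 / q)"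
  have P_iff: "?P n \<longleftrightarrow> 1 \<le> n \<and> \<alpha> (n - 1) \<le> 2 * e * C_bd" for n
  proof -
    have "1 \<le> C_bd powr (1 / q) * noi_error n powr (1 / q) \<longleftrightarrow> 1 \<le> (C_bd * noi_error n) powr (1 / q)"
      using C_bd noi_error_pos[of n] by (simp add: powr_mult)
    also have "\<dots> \<longleftrightarrow> 1 \<le> C_bd * noi_error n"
      using q mult_pos_pos[OF C_bd noi_error_pos[of n]] powr_mono2[of "1 / q" 1 "C_bd * noi_error n"]
        powr_less_mono2[of "1 / q" "C_bd * noi_error n" 1] by (cases "1 \<le> C_bd * noi_error n") auto
    also have "\<dots> \<longleftrightarrow> \<alpha> (n - 1) \<le> 2 * e * C_bd"
      using alpha_pos[of "n - 1"] by (simp add: Phi_noi_def field_simps)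
    finally show ?thesis by simp
  qed
  have "0 < 2 * e * C_bd" using e_pos C_bd by simp
  then obtain n where "\<alpha> n \<le> 2 * e * C_bd"
    using order_tendstoD(2)[OF alpha_tendsto]
    by (metis eventually_sequentially less_imp_le order_refl)
  then have "?P (Suc n)" unfolding P_iff by simp
  then have "?P ?N" unfolding N_max_def by (rule LeastI)
  then have N: "1 \<le> ?N" "\<alpha> (?N - 1) \<le> 2 * e * C_bd" unfolding P_iff by auto
  have "2 * \<beta>\<^sub>2 * rate (\<alpha> (?N - 1)) \<le> 1 / C_bd"
    by (rule rate_below) (use N alpha_pos[of "?N - 1"] in auto)
  also have "\<dots> \<le> noi_error ?N"
    using N C_bd alpha_pos[of "?N - 1"] by (simp add: Phi_noi_def field_simps)
  finally show ?thesis using N by (simp add: dominated_def)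
qed

definition balance :: nat where
  "balance = (LEAST n. dominated n)"

lemma dominated_balance: "dominated balance"
  unfolding balance_def by (rule LeastI[of dominated, OF dominated_N_max])

lemma balance_le_N_max: "balance \<le> N_max C_bd q \<alpha> e"
  unfolding balance_def by (rule Least_le[of dominated, OF dominated_N_max])

text \<open>If the parameter governing the balance index is at least \<open>alpha_opt\<close>, its noise error is at most
\<open>e / alpha_opt \<le> \<Lambda>(alpha_opt)\<close> up to the factor \<open>2\<close>.  Otherwise the preceding index exists, the approximation
error dominates there, and the two indices differ by one step of the parameter sequence.\<close>

lemma noi_error_balance_le: "noi_error balance \<le> (2 + 2 * \<beta>\<^sub>2 * C_dec ^ 3) * rate alpha_opt"
proof -
  obtain k where k: "balance = Suc k"
    using dominated_balance by (cases balance) (auto simp: dominated_def)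
  have rs: "0 \<le> rate alpha_opt" using rate_nonneg alpha_opt_pos by simp
  show ?thesis
  proof (cases "alpha_opt \<le> \<alpha> k")
    case True
    have "noi_error balance \<le> 2 * e / alpha_opt"
      using True e_pos alpha_opt_pos by (simp add: Phi_noi_def k divide_left_mono)
    also have "\<dots> \<le> 2 * rate alpha_opt"
      using conjugate_le_rate[OF alpha_opt_pos] alpha_opt_pos by (simp add: conjugate_alpha_opt field_simps)
    also have "\<dots> \<le> (2 + 2 * \<beta>\<^sub>2 * C_dec ^ 3) * rate alpha_opt"
      using rs beta2 C_dec by (intro mult_right_mono) auto
    finally show ?thesis .
  next
    case False
    then obtain j where j: "k = Suc j" using alpha_opt_less by (cases k) auto
    have "\<not> dominated k" using not_less_Least[of k dominated] k by (simp add: balance_def)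
    then have nd: "2 * e / \<alpha> j \<le> 2 * \<beta>\<^sub>2 * rate (\<alpha> j)" by (simp add: dominated_def j Phi_noi_def)
    have "C_dec * \<alpha> (Suc j) \<le> C_dec * alpha_opt" using False j C_dec by (intro mult_left_mono) auto
    then have "rate (\<alpha> j) \<le> C_dec\<^sup>2 * rate alpha_opt"
      using alpha_le_Suc[of j] alpha_pos[of j] alpha_opt_pos by (intro rate_le_quadratic C_dec) auto
    then have *: "2 * \<beta>\<^sub>2 * rate (\<alpha> j) \<le> 2 * \<beta>\<^sub>2 * (C_dec\<^sup>2 * rate alpha_opt)"
      using beta2 by (intro mult_left_mono) auto
    have "noi_error balance \<le> C_dec * (2 * e / \<alpha> j)"
      using mult_left_mono[OF alpha_le_Suc[of j], of e] alpha_pos[of j] alpha_pos[of "Suc j"] e_pos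
      by (simp add: Phi_noi_def k j field_simps)
    also have "\<dots> \<le> C_dec * (2 * \<beta>\<^sub>2 * (C_dec\<^sup>2 * rate alpha_opt))"
      using nd * C_dec by (intro mult_left_mono) auto
    also have "\<dots> = 2 * \<beta>\<^sub>2 * C_dec ^ 3 * rate alpha_opt" by (simp add: power2_eq_square power3_eq_cube)
    also have "\<dots> \<le> (2 + 2 * \<beta>\<^sub>2 * C_dec ^ 3) * rate alpha_opt" using rs by (intro mult_right_mono) auto
    finally show ?thesis .
  qed
qed

text \<open>The balance index passes the test of the rule, because two iterates beyond it are both within the noise error of
the exact solution.  Hence the rule stops no later, and its own test compares the chosen iterate with the one at the
balance index.\<close>

lemma lepskij_rate:
  fixes n :: nat
  defines "n \<equiv> n_bal C_bd q \<alpha> e (ereal (4 * C_bd powr (1 / q)) * (1 + ereal gamma)) u"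
  shows "norm (u n - ud) powr q
      \<le> (6 * C_bd powr (1 / q) * (1 + gamma_max)) powr q * (2 + 2 * \<beta>\<^sub>2 * C_dec ^ 3) * rate alpha_opt"
proof -
  let ?b = balance
  let ?c = "C_bd powr (1 / q) * (1 + gamma)"
  let ?good = "\<lambda>n. n \<in> {1..N_max C_bd q \<alpha> e} \<and>
        (\<forall>m\<ge>n. norm (u n - u m) \<le> 4 * ?c * noi_error m powr (1 / q))"
  have c: "0 \<le> ?c" using gamma_nonneg by simp
  have n: "n = (LEAST n. ?good n)"
    by (simp add: n_def n_bal_def one_ereal_def mult.assoc)
  have "?good ?b"
  proof (intro conjI allI impI)
    show "?b \<in> {1..N_max C_bd q \<alpha> e}"
      using dominated_balance balance_le_N_max by (auto simp: dominated_def)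
    fix m assume m: "?b \<le> m"
    have "norm (u ?b - u m) \<le> norm (u ?b - ud) + norm (u m - ud)"
      using norm_triangle_ineq4[of "u ?b - ud" "u m - ud"] by simp
    also have "\<dots> \<le> 2 * ?c * noi_error ?b powr (1 / q) + 2 * ?c * noi_error m powr (1 / q)"
      using norm_le_of_dominated[OF dominated_balance]
        norm_le_of_dominated[OF dominated_mono[OF dominated_balance m]] by (simp add: mult.assoc)
    also have "2 * ?c * noi_error ?b powr (1 / q) \<le> 2 * ?c * noi_error m powr (1 / q)"
      using c q noi_error_mono[OF m] noi_error_pos[of ?b] by (intro mult_left_mono powr_mono2) auto
    finally show "norm (u ?b - u m) \<le> 4 * ?c * noi_error m powr (1 / q)" by (simp add: ac_simps)
  qed
  then have "?good n" "n \<le> ?b"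
    unfolding n by (rule LeastI, rule Least_le)
  then have "norm (u n - u ?b) \<le> 4 * ?c * noi_error ?b powr (1 / q)" by blast
  moreover have "norm (u n - ud) \<le> norm (u n - u ?b) + norm (u ?b - ud)"
    using norm_triangle_ineq[of "u n - u ?b" "u ?b - ud"] by simp
  ultimately have "norm (u n - ud) \<le> 6 * ?c * noi_error ?b powr (1 / q)"
    using norm_le_of_dominated[OF dominated_balance] by (simp add: mult.assoc)
  also have "\<dots> \<le> 6 * C_bd powr (1 / q) * (1 + gamma_max) * noi_error ?b powr (1 / q)"
    using gamma_le_max by (auto simp: mult.assoc intro!: mult_left_mono mult_right_mono)
  finally have "norm (u n - ud) powr q
      \<le> (6 * C_bd powr (1 / q) * (1 + gamma_max) * noi_error ?b powr (1 / q)) powr q"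
    using q by (intro powr_mono2) auto
  also have "\<dots> = (6 * C_bd powr (1 / q) * (1 + gamma_max)) powr q * noi_error ?b"
    using q gamma_max_nonneg noi_error_pos[of ?b] by (simp add: powr_mult powr_powr)
  also have "\<dots> \<le> (6 * C_bd powr (1 / q) * (1 + gamma_max)) powr q * ((2 + 2 * \<beta>\<^sub>2 * C_dec ^ 3) * rate alpha_opt)"
    using noi_error_balance_le by (intro mult_left_mono) auto
  finally show ?thesis by (simp add: mult.assoc)
qed

end

section \<open>The convergence theorem\<close>

context newton_problem
begin

lemma exact_data_convergence:
  fixes \<iota> :: "'y \<Rightarrow> 'o" and u :: "nat \<Rightarrow> 'x"
  assumes "\<iota> (F ud) \<in> Yobs" "error_bound C_err T S (F ud) (\<iota> (F ud)) (\<lambda>_. 0)"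
    "newton_iterates B F R S \<alpha> (\<iota> (F ud)) u\<^sub>0 u"
  shows "\<exists>C>0. \<forall>\<^sub>F n in sequentially. bregman R us (u n) ud \<le> ereal C * Lam \<phi> (\<alpha> n)"
proof -
  have err: "err_term ty C_err C_tc \<eta> F ud (\<lambda>_. 0) u n = 0" for n by (cases ty) auto
  interpret newton_run \<phi> g0 B F R ud T Yobs S us u\<^sub>0 \<alpha> ty \<eta> \<beta>\<^sub>1 \<beta>\<^sub>2 C_err C_tc C_dec
    "\<iota> (F ud)" "\<lambda>_. 0" 0 u
    by unfold_locales (use assms in \<open>auto simp: err\<close>)
  let ?C = "(1 + gamma_max) * (2 * \<beta>\<^sub>2 * C_dec\<^sup>2)"
  have "bregman R us (u (Suc n)) ud \<le> ereal ?C * Lam \<phi> (\<alpha> (Suc n))" for n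
    using exact_data_rate[OF refl, of n] alpha_pos[of "Suc n"]
    by (simp add: bregman_eq_D Lam_eq_rate less_imp_le)
  then have "\<forall>\<^sub>F n in sequentially. bregman R us (u n) ud \<le> ereal ?C * Lam \<phi> (\<alpha> n)"
    by (intro eventually_sequentiallyI[of 1]) (metis Suc_le_D One_nat_def)
  moreover have "0 < ?C"
    using gamma_max_nonneg beta2 C_dec by (intro mult_pos_pos) auto
  ultimately show ?thesis by blast
qed

lemma noisy_runI:
  assumes "gobs \<in> Yobs"
    and "error_bound C_err T S (F ud) gobs err \<and> newton_iterates B F R S \<alpha> gobs u\<^sub>0 u \<and>
      (\<forall>n. err_term ty C_err C_tc \<eta> F ud err u n \<le> ereal e) \<and> 0 < e \<and> e < \<epsilon>"
    and "\<epsilon> \<le> conjugate (\<alpha> 0)"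
  shows "noisy_run \<phi> g0 B F R ud T Yobs S us u\<^sub>0 \<alpha> ty \<eta> \<beta>\<^sub>1 \<beta>\<^sub>2 C_err C_tc C_dec gobs err e u"
  by unfold_locales (use assms in auto)

lemma a_priori_convergence:
  "\<exists>C>0. \<exists>\<epsilon>>0. \<forall>gobs\<in>Yobs. \<forall>err e u.
     error_bound C_err T S (F ud) gobs err \<and>
     newton_iterates B F R S \<alpha> gobs u\<^sub>0 u \<and>
     (\<forall>n. err_term ty C_err C_tc \<eta> F ud err u n \<le> ereal e) \<and> 0 < e \<and> e < \<epsilon>
     \<longrightarrow> bregman R us (u (n_star \<phi> \<alpha> e)) ud \<le> ereal C * Lam \<phi> (Psi_inv \<phi> e)"
    (is "\<exists>C>0. \<exists>\<epsilon>>0. \<forall>gobs\<in>Yobs. \<forall>err e u. ?run gobs err e u \<epsilon> \<longrightarrow> ?bound C e u")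
proof -
  let ?C = "(1 + gamma_max) * (2 * \<beta>\<^sub>2 + 2) * C_dec\<^sup>2" and ?\<epsilon> = "conjugate (\<alpha> 0)"
  have "?bound ?C e u" if "gobs \<in> Yobs" "?run gobs err e u ?\<epsilon>" for gobs err e u
  proof -
    interpret noisy_run \<phi> g0 B F R ud T Yobs S us u\<^sub>0 \<alpha> ty \<eta> \<beta>\<^sub>1 \<beta>\<^sub>2 C_err C_tc C_dec gobs err e u
      by (rule noisy_runI[OF that order_refl])
    show ?thesis using a_priori_rate alpha_opt_pos by (simp add: Lam_eq_rate less_imp_le)
  qed
  moreover have "0 < ?C" using gamma_max_nonneg beta2 C_dec by (intro mult_pos_pos) auto
  ultimately show ?thesis using conjugate_pos[OF alpha_pos] by blast
qed

lemma lepskij_convergence: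
  assumes q: "1 < q" and C_bd: "0 < C_bd"
    and coercive: "\<forall>v. ereal (norm (v - ud) powr q) \<le> ereal C_bd * bregman R us v ud"
  shows "\<exists>C>0. \<exists>\<epsilon>>0. \<forall>gobs\<in>Yobs. \<forall>err e u.
     error_bound C_err T S (F ud) gobs err \<and>
     newton_iterates B F R S \<alpha> gobs u\<^sub>0 u \<and>
     (\<forall>n. err_term ty C_err C_tc \<eta> F ud err u n \<le> ereal e) \<and> 0 < e \<and> e < \<epsilon>
     \<longrightarrow>
     (let \<gamma> = gamma_nl C_err C_tc C_dec \<eta> \<beta>\<^sub>2 \<phi> \<alpha> (\<lambda>v. T (F ud) (F v)) e u;
          n = n_bal C_bd q \<alpha> e (ereal (4 * C_bd powr (1 / q)) * (1 + \<gamma>)) u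
      in ereal (norm (u n - ud) powr q) \<le> ereal C * Lam \<phi> (Psi_inv \<phi> e))"
    (is "\<exists>C>0. \<exists>\<epsilon>>0. \<forall>gobs\<in>Yobs. \<forall>err e u. ?run gobs err e u \<epsilon> \<longrightarrow> ?bound C e u")
proof -
  have "0 < 1 / (2 * \<beta>\<^sub>2 * C_bd)" using beta2 C_bd by simp
  then obtain d where d: "0 < d" "\<And>t. 0 \<le> t \<Longrightarrow> t < d \<Longrightarrow> rate t < 1 / (2 * \<beta>\<^sub>2 * C_bd)"
    using rate_small by metis
  let ?C = "(6 * C_bd powr (1 / q) * (1 + gamma_max)) powr q * (2 + 2 * \<beta>\<^sub>2 * C_dec ^ 3)"
  let ?\<epsilon> = "min (conjugate (\<alpha> 0)) (d / (2 * C_bd))"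
  have "?bound ?C e u" if run: "gobs \<in> Yobs" "?run gobs err e u ?\<epsilon>" for gobs err e u
  proof -
    interpret noisy_run \<phi> g0 B F R ud T Yobs S us u\<^sub>0 \<alpha> ty \<eta> \<beta>\<^sub>1 \<beta>\<^sub>2 C_err C_tc C_dec gobs err e u
      by (rule noisy_runI[OF run]) simp
    interpret coercive_run \<phi> g0 B F R ud T Yobs S us u\<^sub>0 \<alpha> ty \<eta> \<beta>\<^sub>1 \<beta>\<^sub>2 C_err C_tc C_dec
      gobs err e u q C_bd
    proof
      fix t :: real assume t: "0 \<le> t" "t \<le> 2 * e * C_bd"
      have "2 * e * C_bd < d" using run(2) C_bd by (simp add: field_simps)
      then have "rate t < 1 / (2 * \<beta>\<^sub>2 * C_bd)" using d(2)[of t] t by simp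
      then show "2 * \<beta>\<^sub>2 * rate t \<le> 1 / C_bd" using beta2 C_bd by (simp add: field_simps)
    qed (use q C_bd coercive in auto)
    show ?thesis
      using lepskij_rate alpha_opt_pos unfolding Let_def gamma_nl_eq
      by (simp add: Lam_eq_rate less_imp_le)
  qed
  moreover have "0 < ?C"
    using gamma_max_nonneg beta2 C_dec C_bd by (intro mult_pos_pos add_pos_nonneg) auto
  moreover have "0 < ?\<epsilon>" using conjugate_pos[OF alpha_pos] d C_bd by simp
  ultimately show ?thesis by blast
qed

end


theorem theorem4p2:
  fixes C_err C_tc C_dec \<beta>\<^sub>1 :: real
    and \<phi> :: "real \<Rightarrow> real"
    and \<alpha> :: "nat \<Rightarrow> real"
    and ty :: cone_type
  assumes "1 \<le> C_err" and "1 \<le> C_tc"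
    and "0 \<le> \<beta>\<^sub>1" and "\<beta>\<^sub>1 < 1 / 2"
    and "source_index_function \<phi>"
    and "regularization_parameters C_dec \<alpha>"
  shows "\<exists>\<eta>max>0. \<exists>\<beta>max>0. \<exists>Dmax>0. \<exists>Tmax>0.
    \<forall>(B :: 'x::banach set) (F :: 'x \<Rightarrow> 'y::banach) R ud T (Yobs :: 'o set) S us \<eta> \<beta>\<^sub>2 u\<^sub>0.
      forward_operator B F \<and> proper_convex R \<and> data_functionals B F ud T Yobs S \<and>
      tangential_cone ty \<eta> C_tc B F ud T Yobs S \<and>
      additive_vsc B F R T ud us \<beta>\<^sub>1 \<beta>\<^sub>2 \<phi> \<and>
      u\<^sub>0 \<in> B \<and>
      0 \<le> \<eta> \<and> \<eta> \<le> \<eta>max \<and> 0 < \<beta>\<^sub>2 \<and> \<beta>\<^sub>2 \<le> \<beta>max \<and>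
      bregman R us u\<^sub>0 ud \<le> ereal Dmax \<and> T (F ud) (F u\<^sub>0) \<le> ereal Tmax
      \<longrightarrow>
      (\<forall>(\<iota> :: 'y \<Rightarrow> 'o) u.
         \<iota> (F ud) \<in> Yobs \<and> error_bound C_err T S (F ud) (\<iota> (F ud)) (\<lambda>_. 0) \<and>
         newton_iterates B F R S \<alpha> (\<iota> (F ud)) u\<^sub>0 u
         \<longrightarrow> (\<exists>C>0. \<forall>\<^sub>F n in sequentially. bregman R us (u n) ud \<le> ereal C * Lam \<phi> (\<alpha> n)))
      \<and>
      (\<exists>C>0. \<exists>\<epsilon>>0. \<forall>gobs\<in>Yobs. \<forall>err e u.
         error_bound C_err T S (F ud) gobs err \<and>
         newton_iterates B F R S \<alpha> gobs u\<^sub>0 u \<and>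
         (\<forall>n. err_term ty C_err C_tc \<eta> F ud err u n \<le> ereal e) \<and> 0 < e \<and> e < \<epsilon>
         \<longrightarrow> bregman R us (u (n_star \<phi> \<alpha> e)) ud \<le> ereal C * Lam \<phi> (Psi_inv \<phi> e))
      \<and>
      (\<forall>q C_bd.
         1 < q \<and> 0 < C_bd \<and>
         (\<forall>u. ereal (norm (u - ud) powr q) \<le> ereal C_bd * bregman R us u ud)
         \<longrightarrow>
         (\<exists>C>0. \<exists>\<epsilon>>0. \<forall>gobs\<in>Yobs. \<forall>err e u.
            error_bound C_err T S (F ud) gobs err \<and>
            newton_iterates B F R S \<alpha> gobs u\<^sub>0 u \<and>
            (\<forall>n. err_term ty C_err C_tc \<eta> F ud err u n \<le> ereal e) \<and> 0 < e \<and> e < \<epsilon>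
            \<longrightarrow>
            (let \<gamma> = gamma_nl C_err C_tc C_dec \<eta> \<beta>\<^sub>2 \<phi> \<alpha> (\<lambda>v. T (F ud) (F v)) e u;
                 n = n_bal C_bd q \<alpha> e (ereal (4 * C_bd powr (1 / q)) * (1 + \<gamma>)) u
             in ereal (norm (u n - ud) powr q) \<le> ereal C * Lam \<phi> (Psi_inv \<phi> e))))"
proof -
  note C_err = assms(1) and C_tc = assms(2) and params = assms(6)
  have C_dec: "1 \<le> C_dec"
    using params unfolding regularization_parameters_def by (meson order.trans)
  have NL: "0 < C_NL C_err" using C_err by (simp add: C_NL_def)
  \<comment> \<open>With these thresholds \<open>1 / (C_tc C_err) - \<beta>\<^sub>2 \<ge> \<beta>max\<close>, and the contraction factor is at most
    \<open>C_dec\<^sup>3 \<eta>max C_NL / \<beta>max = 1 / 2\<close>.\<close>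
  define \<beta>max where "\<beta>max = 1 / (2 * C_tc * C_err)"
  define \<eta>max where "\<eta>max = 1 / (4 * C_dec ^ 3 * C_NL C_err * C_tc * C_err)"
  have \<beta>max: "0 < \<beta>max" using C_err C_tc by (simp add: \<beta>max_def)
  have \<eta>max: "0 < \<eta>max" using C_err C_tc C_dec NL by (simp add: \<eta>max_def)
  have small: "\<beta>\<^sub>2 < 1 / (C_tc * C_err)" "C_dec\<^sup>2 * gamma_bar C_err C_tc C_dec \<eta> \<beta>\<^sub>2 < 1"
    if "0 \<le> \<eta>" "\<eta> \<le> \<eta>max" "\<beta>\<^sub>2 \<le> \<beta>max" for \<eta> \<beta>\<^sub>2
  proof -
    have double: "1 / (C_tc * C_err) = 2 * \<beta>max" by (simp add: \<beta>max_def)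
    show "\<beta>\<^sub>2 < 1 / (C_tc * C_err)" using that \<beta>max unfolding double by simp
    have "C_dec\<^sup>2 * gamma_bar C_err C_tc C_dec \<eta> \<beta>\<^sub>2 \<le> C_dec\<^sup>2 * (\<eta>max * C_dec * C_NL C_err / \<beta>max)"
      unfolding gamma_bar_def double using that \<beta>max \<eta>max C_dec NL
      by (intro mult_left_mono frac_le mult_right_mono mult_nonneg_nonneg) auto
    also have "\<dots> = 1 / 2"
      using C_err C_tc C_dec NL
      by (simp add: \<eta>max_def \<beta>max_def power2_eq_square power3_eq_cube)
    finally show "C_dec\<^sup>2 * gamma_bar C_err C_tc C_dec \<eta> \<beta>\<^sub>2 < 1" by simp
  qed
  show ?thesis
  proof (rule exI[of _ \<eta>max], rule conjI[OF \<eta>max], rule exI[of _ \<beta>max], rule conjI[OF \<beta>max],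
      rule exI[of _ 1], rule conjI[OF zero_less_one], rule exI[of _ 1], rule conjI[OF zero_less_one],
      intro allI impI, elim conjE, goal_cases)
    case (1 B F R ud T Yobs S us \<eta> \<beta>\<^sub>2 u\<^sub>0)
    show ?case
    proof (cases "majorants \<phi> = {}")
      case True
      then have "Lam \<phi> t = \<infinity>" for t by (rule Lam_top)
      then show ?thesis unfolding Let_def by (auto intro!: exI[of _ "1 :: real"])
    next
      case False
      then obtain g0 where g0: "g0 \<in> majorants \<phi>" by blast
      interpret newton_problem \<phi> g0 B F R ud T Yobs S us u\<^sub>0 \<alpha> ty \<eta> \<beta>\<^sub>1 \<beta>\<^sub>2 C_err C_tc C_dec
      proof
        show "T (F ud) (F u\<^sub>0) < \<infinity>" using 1 by (auto intro: le_less_trans)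
      qed (use assms 1 g0 small[of \<eta> \<beta>\<^sub>2] in auto)
      show ?thesis
        by (intro conjI allI impI a_priori_convergence; elim conjE;
            (rule exact_data_convergence | rule lepskij_convergence); assumption)
    qed
  qed
qed

end
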